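(* Let $\mathbf{k}$ be a field of characteristic $0$, let $B$ be an affine $\mathbf{k}$-domain graded over $\mathbf{k}$ by an abelian group $G$, and let $H \in \mathbb{T}(B)$. (a) For each $A \in \mathrm{KHLND}(B)$, we have $A^{(H)} \in \mathrm{KHLND}(B^{(H)})$. (b) The map $\mathrm{KHLND}(B) \to \mathrm{KHLND}(B^{(H)})$, $A \mapsto A^{(H)}$, is injective. (c) If $\mathrm{HLND}(B) \neq \{0\}$ then $\mathrm{HLND}(B^{(H)}) \neq \{0\}$. (d) If $G$ is torsion-free and $B$ is non-rigid then $B^{(H)}$ is non-rigid.
   Context: Rings are commutative, associative and unital; "domain" means integral domain. An affine $\mathbf{k}$-domain is a domain that is a finitely generated $\mathbf{k}$-algebra. For an abelian group $G$ (written additively), a $G$-graded ring is a ring $B=\bigoplus_{i\in G}B_i$ with $B_iB_j\subseteq B_{i+j}$. A $\mathbf{k}$-algebra $B$ is graded over $\mathbf{k}$ by $G$ if it is $G$-graded and $\mathbf{k}\subseteq B_0$. For a $G$-graded domain $B$, $\mathbb{G}(B)$ is the subgroup of $G$ generated by $\{i\in G : B_i\neq 0\}$. For a subgroup $H$ of $G$ and a $G$-graded ring $A$ (for instance a graded subring of $B$), $A^{(H)}=\bigoplus_{i\in H}A_i$; this is an $H$-graded ring. $\mathbb{T}(B)$ is the set of subgroups $H$ of $G$ such that $\mathbb{G}(B)/(H\cap\mathbb{G}(B))$ is a torsion group. A derivation $D:B\to B$ is locally nilpotent if for each $b\in B$ there is $n>0$ with $D^n(b)=0$; $\mathrm{LND}(B)$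 is the set of locally nilpotent derivations of $B$. A ring $B$ is rigid if $\mathrm{LND}(B)=\{0\}$. A derivation $D$ of a graded ring $B$ is homogeneous if there is $d$ in the grading group with $D(B_i)\subseteq B_{i+d}$ for all $i$. $\mathrm{HLND}(B)$ is the set of homogeneous locally nilpotent derivations of $B$, and $\mathrm{KHLND}(B)=\{\ker D : D\in\mathrm{HLND}(B),\ D\neq 0\}$ (kernels of homogeneous derivations are graded subrings of $B$). *)

theory Defs
  imports "HOL-Algebra.Algebra"
begin

definition characteristic_zero :: "('a, 'm) ring_scheme \<Rightarrow> bool" where
  "characteristic_zero R \<longleftrightarrow> (\<forall>n::nat. n > 0 \<longrightarrow> [n] \<cdot>\<^bsub>R\<^esub> \<one>\<^bsub>R\<^esub> \<noteq> \<zero>\<^bsub>R\<^esub>)"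

text \<open>A domain over a field is given by its ground field \<open>K\<close> as a subfield: the structure map of a
  nonzero algebra over a field is injective.\<close>

definition affine_domain :: "'a set \<Rightarrow> ('a, 'm) ring_scheme \<Rightarrow> bool" where
  "affine_domain K R \<longleftrightarrow> domain R \<and> subfield K R \<and>
     (\<exists>S. finite S \<and> S \<subseteq> carrier R \<and> generate_ring R (K \<union> S) = carrier R)"

definition torsion_group :: "('g, 'n) monoid_scheme \<Rightarrow> bool" where
  "torsion_group G \<longleftrightarrow> (\<forall>x\<in>carrier G. \<exists>n::nat. n > 0 \<and> x [^]\<^bsub>G\<^esub> n = \<one>\<^bsub>G\<^esub>)"

definition torsion_free_group :: "('g, 'n) monoid_scheme \<Rightarrow> bool" where
  "torsion_free_group G \<longleftrightarrow>
     (\<forall>x\<in>carrier G. \<forall>n::nat. n > 0 \<longrightarrow> x [^]\<^bsub>G\<^esub> n = \<one>\<^bsub>G\<^esub> \<longrightarrow> x = \<one>\<^bsub>G\<^esub>)"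

text \<open>The grading group is an arbitrary abelian group, written multiplicatively as in the library.
  The values of the component function \<open>B\<close> outside \<open>carrier G\<close> are irrelevant, so the same \<open>B\<close> also
  serves as the component function of gradings by subgroups of \<open>G\<close>.\<close>

locale graded_ring = G: comm_group G + R: cring R
  for G :: "('g, 'n) monoid_scheme" and R :: "('a, 'm) ring_scheme" +
  fixes B :: "'g \<Rightarrow> 'a set"
  assumes component_subgroup: "i \<in> carrier G \<Longrightarrow> additive_subgroup (B i) R"
    and direct_sum: "x \<in> carrier R \<Longrightarrow>
      \<exists>!f. f \<in> (\<Pi>\<^sub>E i\<in>carrier G. B i) \<and> finite {i \<in> carrier G. f i \<noteq> \<zero>\<^bsub>R\<^esub>} \<and>
           x = finsum R f {i \<in> carrier G. f i \<noteq> \<zero>\<^bsub>R\<^esub>}"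
    and component_mult: "\<lbrakk>i \<in> carrier G; j \<in> carrier G; x \<in> B i; y \<in> B j\<rbrakk>
      \<Longrightarrow> x \<otimes>\<^bsub>R\<^esub> y \<in> B (i \<otimes>\<^bsub>G\<^esub> j)"

definition graded_over ::
  "'a set \<Rightarrow> ('g, 'n) monoid_scheme \<Rightarrow> ('a, 'm) ring_scheme \<Rightarrow> ('g \<Rightarrow> 'a set) \<Rightarrow> bool" where
  "graded_over K G R B \<longleftrightarrow> graded_ring G R B \<and> K \<subseteq> B \<one>\<^bsub>G\<^esub>"

definition support_group ::
  "('g, 'n) monoid_scheme \<Rightarrow> ('a, 'm) ring_scheme \<Rightarrow> ('g \<Rightarrow> 'a set) \<Rightarrow> 'g set" where
  "support_group G R B = generate G {i \<in> carrier G. B i \<noteq> {\<zero>\<^bsub>R\<^esub>}}"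

definition cotorsion_subgroups ::
  "('g, 'n) monoid_scheme \<Rightarrow> ('a, 'm) ring_scheme \<Rightarrow> ('g \<Rightarrow> 'a set) \<Rightarrow> 'g set set" where
  "cotorsion_subgroups G R B =
     {H. subgroup H G \<and>
         torsion_group (G\<lparr>carrier := support_group G R B\<rparr> Mod (H \<inter> support_group G R B))}"

text \<open>For a graded subring \<open>A\<close>, with components \<open>A \<inter> B i\<close>, this is the sum of the components of \<open>A\<close>
  with degree in \<open>H\<close>.\<close>

definition veronese ::
  "('a, 'm) ring_scheme \<Rightarrow> ('g \<Rightarrow> 'a set) \<Rightarrow> 'g set \<Rightarrow> 'a set \<Rightarrow> 'a set" where
  "veronese R B H A =
     {x. \<exists>f \<in> (\<Pi>\<^sub>E i\<in>H. A \<inter> B i). finite {i \<in> H. f i \<noteq> \<zero>\<^bsub>R\<^esub>} \<and>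
           x = finsum R f {i \<in> H. f i \<noteq> \<zero>\<^bsub>R\<^esub>}}"

definition veronese_ring ::
  "('a, 'm) ring_scheme \<Rightarrow> ('g \<Rightarrow> 'a set) \<Rightarrow> 'g set \<Rightarrow> ('a, 'm) ring_scheme" where
  "veronese_ring R B H = R\<lparr>carrier := veronese R B H (carrier R)\<rparr>"

text \<open>Derivations are extensional functions, so that equality of derivations is equality on the
  carrier. They are not required to be linear over a ground field.\<close>

definition derivations :: "('a, 'm) ring_scheme \<Rightarrow> ('a \<Rightarrow> 'a) set" where
  "derivations R =
     {D \<in> carrier R \<rightarrow>\<^sub>E carrier R. \<forall>x\<in>carrier R. \<forall>y\<in>carrier R.
        D (x \<oplus>\<^bsub>R\<^esub> y) = D x \<oplus>\<^bsub>R\<^esub> D y \<and>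
        D (x \<otimes>\<^bsub>R\<^esub> y) = (D x \<otimes>\<^bsub>R\<^esub> y) \<oplus>\<^bsub>R\<^esub> (x \<otimes>\<^bsub>R\<^esub> D y)}"

definition zero_derivation :: "('a, 'm) ring_scheme \<Rightarrow> 'a \<Rightarrow> 'a" where
  "zero_derivation R = (\<lambda>x\<in>carrier R. \<zero>\<^bsub>R\<^esub>)"

definition LND :: "('a, 'm) ring_scheme \<Rightarrow> ('a \<Rightarrow> 'a) set" where
  "LND R = {D \<in> derivations R. \<forall>x\<in>carrier R. \<exists>n>0. (D ^^ n) x = \<zero>\<^bsub>R\<^esub>}"

definition rigid :: "('a, 'm) ring_scheme \<Rightarrow> bool" where
  "rigid R \<longleftrightarrow> LND R = {zero_derivation R}"

definition homogeneous :: "('g, 'n) monoid_scheme \<Rightarrow> ('g \<Rightarrow> 'a set) \<Rightarrow> ('a \<Rightarrow> 'a) \<Rightarrow> bool" where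
  "homogeneous G B D \<longleftrightarrow> (\<exists>d\<in>carrier G. \<forall>i\<in>carrier G. D ` B i \<subseteq> B (i \<otimes>\<^bsub>G\<^esub> d))"

definition HLND ::
  "('g, 'n) monoid_scheme \<Rightarrow> ('a, 'm) ring_scheme \<Rightarrow> ('g \<Rightarrow> 'a set) \<Rightarrow> ('a \<Rightarrow> 'a) set" where
  "HLND G R B = {D \<in> LND R. homogeneous G B D}"

definition KHLND ::
  "('g, 'n) monoid_scheme \<Rightarrow> ('a, 'm) ring_scheme \<Rightarrow> ('g \<Rightarrow> 'a set) \<Rightarrow> 'a set set" where
  "KHLND G R B = {a_kernel R R D | D. D \<in> HLND G R B \<and> D \<noteq> zero_derivation R}"

end

theory Submission
  imports Defs
begin

text \<open>Let \<open>D\<close> be a nonzero homogeneous locally nilpotent derivation with kernel \<open>A\<close>, and let \<open>s\<close> be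
  homogeneous with \<open>D s \<noteq> 0 = D (D s)\<close>. After inverting the nonzero homogeneous elements of \<open>A\<close>,
  the ring becomes a polynomial ring in \<open>s\<close>, whose part with degrees in \<open>H\<close> is a polynomial
  ring in some \<open>t = c s\<^sup>e\<close> with minimal \<open>e\<close>. Up to a factor from the kernel \<open>d/dt\<close> is \<open>s\<^sup>1\<^sup>-\<^sup>e D\<close>. Since the
  Veronese subring is finitely generated, some homogeneous \<open>h\<close> in \<open>A\<close> makes \<open>h D b\<close> divisible by
  \<open>s\<^sup>e\<^sup>-\<^sup>1\<close> for every \<open>b\<close> in the subring, and \<open>h\<close> can be chosen such that the quotient has degree in
  \<open>H\<close>. This quotient is a locally nilpotent derivation with kernel \<open>A \<inter> V\<close>, where \<open>V\<close> is the
  subring. Injectivity holds because kernels are closed under taking roots and every homogeneous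
  element has a power in \<open>V\<close>. If the grading group is torsion-free, it can be totally ordered, and
  the leading homogeneous component of a locally nilpotent derivation is locally nilpotent.\<close>

subsection \<open>Derivations and local nilpotency\<close>

text \<open>Degrees are written additively in these comments. \<open>D\<close> need not map
  \<open>V\<close> into \<open>V\<close>, and multiplying \<open>D\<close> by kernel elements need
  not repair this. For \<open>k[x]\<close> graded by the integers, \<open>D = d/dx\<close> and
  \<open>H\<close> the multiples of some \<open>e > 1\<close>, the kernel is \<open>k\<close> and
  \<open>V = k[x^e]\<close>, but \<open>D (x^e) = e x^(e-1)\<close> lies outside \<open>V\<close>.
  Division by \<open>x^(e-1)\<close> is what brings the values back. In general this division needs
  denominators from the kernel. The localisation is never formed: its polynomial structure survives
  only as the statement that \<open>s^(e-1)\<close> divides \<open>f D b\<close> for a nonzero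
  homogeneous kernel element \<open>f\<close>. At first \<open>f\<close> depends on
  \<open>b\<close>; finite generation makes it uniform. The other tool is the order of nilpotency.
  In a domain of characteristic zero the orders of two nonzero factors add up in their product, so
  dividing by a nonzero factor cannot raise the order. This keeps the quotient derivation locally
  nilpotent, and it puts all units, hence the ground field, into the kernel, although derivations
  are only assumed additive.\<close>

locale derivation = cring R for R (structure) +
  fixes D
  assumes derivation: "D \<in> derivations R"
begin

lemma D_closed [simp, intro]: "x \<in> carrier R \<Longrightarrow> D x \<in> carrier R"
  using derivation by (auto simp: derivations_def)

lemma D_add [simp]: "\<lbrakk>x \<in> carrier R; y \<in> carrier R\<rbrakk> \<Longrightarrow> D (x \<oplus> y) = D x \<oplus> D y"
  using derivation by (auto simp: derivations_def)

lemma D_mult: "\<lbrakk>x \<in> carrier R; y \<in> carrier R\<rbrakk> \<Longrightarrow> D (x \<otimes> y) = (D x \<otimes> y) \<oplus> (x \<otimes> D y)"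
  using derivation by (auto simp: derivations_def)

lemma D_zero [simp]: "D \<zero> = \<zero>"
proof -
  have "D \<zero> \<oplus> D \<zero> = D \<zero>"
    using D_add[of \<zero> \<zero>] by simp
  then show ?thesis
    using add.l_cancel_one[of "D \<zero>" "D \<zero>"] by simp
qed

lemma D_minus [simp]: "x \<in> carrier R \<Longrightarrow> D (\<ominus> x) = \<ominus> D x"
  using D_add[of x "\<ominus> x"] by (metis D_closed D_zero add.inv_closed minus_equality minus_minus r_neg)

lemma D_one [simp]: "D \<one> = \<zero>"
proof -
  have "D \<one> \<oplus> D \<one> = D \<one>"
    using D_mult[of \<one> \<one>] by simp
  then show ?thesis
    using add.l_cancel_one[of "D \<one>" "D \<one>"] by simp
qed

lemma D_nat [simp]: "D ([(n::nat)] \<cdot> \<one>) = \<zero>"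
  by (induction n) auto

lemma D_kernel_mult: "\<lbrakk>c \<in> carrier R; D c = \<zero>; x \<in> carrier R\<rbrakk> \<Longrightarrow> D (c \<otimes> x) = c \<otimes> D x"
  by (simp add: D_mult)

lemma D_kernel_pow [simp]: "\<lbrakk>c \<in> carrier R; D c = \<zero>\<rbrakk> \<Longrightarrow> D (c [^] (n::nat)) = \<zero>"
  by (induction n) (auto simp: D_mult)

lemma iter_closed [simp, intro]: "x \<in> carrier R \<Longrightarrow> (D ^^ n) x \<in> carrier R"
  by (induction n) auto

lemma iter_add: "\<lbrakk>x \<in> carrier R; y \<in> carrier R\<rbrakk> \<Longrightarrow> (D ^^ n) (x \<oplus> y) = (D ^^ n) x \<oplus> (D ^^ n) y"
  by (induction n) auto

lemma iter_zero [simp]: "(D ^^ n) \<zero> = \<zero>"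
  by (induction n) auto

lemma iter_minus: "x \<in> carrier R \<Longrightarrow> (D ^^ n) (\<ominus> x) = \<ominus> (D ^^ n) x"
  by (induction n) auto

lemma iter_kernel_mult:
  "\<lbrakk>c \<in> carrier R; D c = \<zero>; x \<in> carrier R\<rbrakk> \<Longrightarrow> (D ^^ n) (c \<otimes> x) = c \<otimes> (D ^^ n) x"
  by (induction n) (auto simp: D_kernel_mult)

lemma iter_zero_mono:
  assumes "(D ^^ m) x = \<zero>" "m \<le> n"
  shows "(D ^^ n) x = \<zero>"
proof -
  have "(D ^^ n) x = (D ^^ (n - m)) ((D ^^ m) x)"
    using assms(2) by (metis add.commute comp_apply funpow_add le_add_diff_inverse)
  then show ?thesis
    using assms(1) by simp
qed

text \<open>In the Leibniz expansion of order \<open>p + q\<close>, every term but one has more than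
  \<open>p\<close> derivatives on \<open>x\<close> or more than \<open>q\<close> on
  \<open>y\<close>. The induction takes off one derivative and joins the two resulting binomial
  coefficients by Pascal's rule.\<close>

lemma iter_mult_top:
  assumes "x \<in> carrier R" "y \<in> carrier R" "(D ^^ Suc p) x = \<zero>" "(D ^^ Suc q) y = \<zero>"
  shows "(D ^^ (p + q)) (x \<otimes> y) = [((p + q) choose p)] \<cdot> \<one> \<otimes> ((D ^^ p) x \<otimes> (D ^^ q) y)"
  using assms
proof (induction "p + q" arbitrary: p q x y)
  case 0
  then show ?case by auto
next
  case (Suc n)
  show ?case
  proof (cases "p = 0 \<or> q = 0")
    \<comment> \<open>A factor of order zero lies in the kernel and commutes with all
      iterates.\<close>
    case True
    then show ?thesis
    proof
      assume "p = 0"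
      with Suc.prems have "(D ^^ q) (x \<otimes> y) = x \<otimes> (D ^^ q) y"
        by (intro iter_kernel_mult) auto
      with \<open>p = 0\<close> Suc.prems(1,2) show ?thesis by simp
    next
      assume "q = 0"
      with Suc.prems have "(D ^^ p) (y \<otimes> x) = y \<otimes> (D ^^ p) x"
        by (intro iter_kernel_mult) auto
      with \<open>q = 0\<close> Suc.prems(1,2) show ?thesis by (simp add: m_comm)
    qed
  next
    case False
    then obtain p' q' where pq: "p = Suc p'" "q = Suc q'"
      by (metis not0_implies_Suc)
    have n: "n = p' + q" "n = p + q'"
      using Suc.hyps(2) pq by auto
    let ?u = "(D ^^ p) x" and ?v = "(D ^^ q) y"
    have 1: "(D ^^ (p' + q)) (D x \<otimes> y) = [((p' + q) choose p')] \<cdot> \<one> \<otimes> (?u \<otimes> ?v)"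
      using Suc.hyps(1)[OF n(1), of "D x" y] Suc.prems pq by (simp add: funpow_swap1)
    have 2: "(D ^^ (p + q')) (x \<otimes> D y) = [((p + q') choose p)] \<cdot> \<one> \<otimes> (?u \<otimes> ?v)"
      using Suc.hyps(1)[OF n(2), of x "D y"] Suc.prems pq by (simp add: funpow_swap1)
    have "(D ^^ (p + q)) (x \<otimes> y) = (D ^^ n) (D (x \<otimes> y))"
      using Suc.hyps(2) by (metis funpow_Suc_right comp_apply)
    also have "\<dots> = (D ^^ n) (D x \<otimes> y) \<oplus> (D ^^ n) (x \<otimes> D y)"
      using Suc.prems by (simp add: D_mult iter_add)
    also have "\<dots> = ([(n choose p')] \<cdot> \<one> \<oplus> [(n choose p)] \<cdot> \<one>) \<otimes> (?u \<otimes> ?v)"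
      using 1 2 Suc.prems n by (simp add: l_distr del: funpow.simps)
    also have "[(n choose p')] \<cdot> \<one> \<oplus> [(n choose p)] \<cdot> \<one> = [((p + q) choose p)] \<cdot> \<one>"
      using Suc.hyps(2) pq by (simp add: add.nat_pow_mult)
    finally show ?thesis .
  qed
qed

text \<open>The value computed by \<open>iter_mult_top\<close> is a product of kernel elements, so
  one more derivative kills it.\<close>

lemma iter_mult_above:
  assumes "x \<in> carrier R" "y \<in> carrier R" "(D ^^ Suc p) x = \<zero>" "(D ^^ Suc q) y = \<zero>"
  shows "(D ^^ Suc (p + q)) (x \<otimes> y) = \<zero>"
proof -
  have "(D ^^ Suc (p + q)) (x \<otimes> y) = D ((D ^^ (p + q)) (x \<otimes> y))"
    by simp
  also have "\<dots> = \<zero>"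
    using assms by (simp add: iter_mult_top D_mult)
  finally show ?thesis .
qed

text \<open>Each further factor \<open>s\<close> has order one and contributes the binomial
  coefficient \<open>n + 1\<close>. The resulting constant \<open>n! (D s)^n\<close> is the
  multiplier that later allows the top term of an element to be cancelled against a multiple of
  \<open>s^n\<close>.\<close>

lemma iter_slice_pow:
  assumes "s \<in> carrier R" "D (D s) = \<zero>"
  shows "(D ^^ n) (s [^] n) = [(fact n :: nat)] \<cdot> \<one> \<otimes> D s [^] n \<and> (D ^^ Suc n) (s [^] n) = \<zero>"
proof (induction n)
  case 0
  show ?case by simp
next
  case (Suc n)
  have "(D ^^ (n + 1)) (s [^] n \<otimes> s) = [((n + 1) choose n)] \<cdot> \<one> \<otimes> ((D ^^ n) (s [^] n) \<otimes> (D ^^ 1) s)"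
    using Suc assms by (intro iter_mult_top) auto
  also have "\<dots> = ([Suc n] \<cdot> \<one> \<otimes> [(fact n :: nat)] \<cdot> \<one>) \<otimes> (D s [^] n \<otimes> D s)"
    using Suc assms by (simp add: m_assoc del: add.nat_pow_Suc)
  also have "[Suc n] \<cdot> \<one> \<otimes> [(fact n :: nat)] \<cdot> \<one> = [(fact (Suc n) :: nat)] \<cdot> \<one>"
    by (simp only: add_pow_ldistr one_closed add.nat_pow_closed l_one add.nat_pow_pow fact_Suc of_nat_id)
       (simp add: mult.commute)
  finally have "(D ^^ Suc n) (s [^] Suc n) = [(fact (Suc n) :: nat)] \<cdot> \<one> \<otimes> D s [^] Suc n"
    by simp
  moreover have "(D ^^ Suc (n + 1)) (s [^] n \<otimes> s) = \<zero>"
    using Suc assms by (intro iter_mult_above) auto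
  ultimately show ?case by simp
qed

lemma D_pow: "x \<in> carrier R \<Longrightarrow> D (x [^] Suc n) = [Suc n] \<cdot> \<one> \<otimes> (x [^] n \<otimes> D x)"
proof (induction n)
  case 0
  then show ?case by simp
next
  case (Suc n)
  let ?t = "x [^] Suc n \<otimes> D x"
  have "D (x [^] Suc (Suc n)) = D (x [^] Suc n) \<otimes> x \<oplus> ?t"
    using Suc.prems by (simp add: D_mult)
  also have "D (x [^] Suc n) \<otimes> x = [Suc n] \<cdot> \<one> \<otimes> ?t"
    using Suc by (simp add: m_ac del: add.nat_pow_Suc)
  also have "[Suc n] \<cdot> \<one> \<otimes> ?t \<oplus> ?t = [Suc (Suc n)] \<cdot> \<one> \<otimes> ?t"
    using Suc.prems by (simp add: l_distr)
  finally show ?case .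
qed

end

lemma (in domain) nat_pow_nonzero:
  "\<lbrakk>x \<in> carrier R; x \<noteq> \<zero>\<rbrakk> \<Longrightarrow> x [^] (n::nat) \<noteq> \<zero>"
  by (induction n) (auto simp: integral_iff)

section \<open>The degree function of a locally nilpotent derivation in characteristic zero\<close>

locale lnd_domain = domain R + derivation R D for R (structure) and D +
  assumes locally_nilpotent: "x \<in> carrier R \<Longrightarrow> \<exists>n. (D ^^ n) x = \<zero>"
    and char_zero: "n > 0 \<Longrightarrow> [(n::nat)] \<cdot> \<one> \<noteq> \<zero>"
begin

text \<open>The number \<open>n\<close> is the degree of \<open>x\<close> with respect to
  \<open>D\<close>, and \<open>(D ^^ n) x\<close> plays the role of its leading coefficient.\<close>

lemma iter_top:
  assumes "x \<in> carrier R" "x \<noteq> \<zero>"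
  obtains n where "(D ^^ n) x \<noteq> \<zero>" "(D ^^ Suc n) x = \<zero>"
proof -
  define n where "n = (LEAST n. (D ^^ n) x = \<zero>)"
  have n: "(D ^^ n) x = \<zero>"
    unfolding n_def using locally_nilpotent[OF assms(1)] by (rule LeastI_ex)
  then obtain m where m: "n = Suc m"
    using assms(2) by (cases n) auto
  have "(D ^^ m) x \<noteq> \<zero>"
    using not_less_Least[of m "\<lambda>n. (D ^^ n) x = \<zero>"] m unfolding n_def[symmetric] by auto
  then show thesis
    using that n m by blast
qed

lemma nat_mult_nonzero:
  "\<lbrakk>n > 0; x \<in> carrier R; x \<noteq> \<zero>\<rbrakk> \<Longrightarrow> [(n::nat)] \<cdot> \<one> \<otimes> x \<noteq> \<zero>"
  using char_zero[of n] integral by auto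

text \<open>Degrees with respect to \<open>D\<close> add: the leading coefficients multiply to
  something nonzero, and the binomial coefficient in front is nonzero in characteristic zero. So for
  nonzero \<open>y\<close> the degree of \<open>y\<close> is at most that of
  \<open>x \<otimes> y\<close>. For \<open>n = 1\<close> this is the factorial closedness of the
  kernel.\<close>

lemma iter_mult_zeroD:
  assumes "x \<in> carrier R" "y \<in> carrier R" "x \<noteq> \<zero>" "(D ^^ n) (x \<otimes> y) = \<zero>"
  shows "(D ^^ n) y = \<zero>"
proof (rule ccontr)
  assume y: "(D ^^ n) y \<noteq> \<zero>"
  then have "y \<noteq> \<zero>" by auto
  obtain p where p: "(D ^^ p) x \<noteq> \<zero>" "(D ^^ Suc p) x = \<zero>"
    using iter_top assms by blast
  obtain q where q: "(D ^^ q) y \<noteq> \<zero>" "(D ^^ Suc q) y = \<zero>"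
    using iter_top assms \<open>y \<noteq> \<zero>\<close> by blast
  have "n \<le> q"
    using y iter_zero_mono[OF q(2), of n] by (meson not_less_eq_eq)
  have "(D ^^ (p + q)) (x \<otimes> y) = \<zero>"
    using iter_zero_mono[OF assms(4)] \<open>n \<le> q\<close> by simp
  moreover have "(D ^^ (p + q)) (x \<otimes> y) \<noteq> \<zero>"
    using iter_mult_top[OF assms(1,2) p(2) q(2)] p(1) q(1) assms
      nat_mult_nonzero[of "(p + q) choose p" "(D ^^ p) x \<otimes> (D ^^ q) y"] integral by auto
  ultimately show False by simp
qed

lemma D_unit:
  assumes "x \<in> carrier R" "y \<in> carrier R" "x \<otimes> y = \<one>"
  shows "D x = \<zero>"
proof -
  have "y \<noteq> \<zero>"
    using assms by auto
  then have "(D ^^ 1) x = \<zero>"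
    using assms m_comm[of x y] by (intro iter_mult_zeroD[of y x 1]) auto
  then show ?thesis by simp
qed

text \<open>Nonzero scalars are units and therefore killed by \<open>D\<close>. Together with
  additivity and the product rule this makes \<open>D\<close> linear over the ground field.\<close>

lemma D_subfield:
  assumes "subfield K R" "x \<in> K"
  shows "D x = \<zero>"
  using D_unit[of x "inv x"] subfield_m_inv[OF assms(1), of x] assms(2)
    subringE(1)[OF subfieldE(1)[OF assms(1)]]
  by (cases "x = \<zero>") auto

text \<open>For \<open>x\<close> nonzero, \<open>D (x^n) = n x^(n-1) D x\<close>, and the factor in
  front of \<open>D x\<close> does not vanish in a domain of characteristic zero.\<close>

lemma D_root:
  assumes "x \<in> carrier R" "n > 0" "D (x [^] (n::nat)) = \<zero>"
  shows "D x = \<zero>"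
proof (cases "x = \<zero>")
  case False
  obtain m where n: "n = Suc m"
    using assms(2) gr0_implies_Suc by blast
  have "x [^] m \<noteq> \<zero>"
    using False assms(1) by (rule nat_pow_nonzero[rotated])
  then show ?thesis
    using assms D_pow[of x m] nat_mult_nonzero[of "Suc m" "x [^] m \<otimes> D x"] n integral by auto
qed simp

end

subsection \<open>Homogeneous components\<close>

lemma (in comm_monoid) finprod_closed_under:
  assumes "\<And>i. i \<in> F \<Longrightarrow> f i \<in> V" "V \<subseteq> carrier G" "\<one> \<in> V"
    and "\<And>x y. \<lbrakk>x \<in> V; y \<in> V\<rbrakk> \<Longrightarrow> x \<otimes> y \<in> V"
  shows "finprod G f F \<in> V"
proof (cases "finite F")
  case True
  then show ?thesis
    using assms(1)
  proof (induction F)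
    case (insert i F)
    then have "finprod G f (insert i F) = f i \<otimes> finprod G f F"
      using assms(2) by (intro finprod_insert) auto
    then show ?case
      using insert assms(4) by auto
  qed (use assms(3) in simp)
qed (use assms(3) in simp)

lemmas (in abelian_monoid) finsum_closed_under = add.finprod_closed_under

locale graded_algebra = domain R + graded_ring G R B for R (structure) and G and B +
  fixes K
  assumes ground_subfield: "subfield K R" and ground_degree: "K \<subseteq> B \<one>\<^bsub>G\<^esub>"
begin

definition proj :: "'c \<Rightarrow> 'a \<Rightarrow> 'a" where
  "proj i x = (THE f. f \<in> (\<Pi>\<^sub>E i\<in>carrier G. B i) \<and> finite {i \<in> carrier G. f i \<noteq> \<zero>} \<and>
     x = finsum R f {i \<in> carrier G. f i \<noteq> \<zero>}) i"

definition supp :: "'a \<Rightarrow> 'c set" where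
  "supp x = {i \<in> carrier G. proj i x \<noteq> \<zero>}"

lemma proj_spec:
  assumes "x \<in> carrier R"
  shows "(\<lambda>i. proj i x) \<in> (\<Pi>\<^sub>E i\<in>carrier G. B i)" and "finite (supp x)"
    and "x = (\<Oplus>i\<in>supp x. proj i x)"
  using theI'[OF direct_sum[OF assms]] unfolding supp_def proj_def by blast+

lemma component_subset: "i \<in> carrier G \<Longrightarrow> x \<in> B i \<Longrightarrow> x \<in> carrier R"
  using additive_subgroup.a_subset[OF component_subgroup] by blast

lemma component_zero [simp]: "i \<in> carrier G \<Longrightarrow> \<zero> \<in> B i"
  by (rule additive_subgroup.zero_closed[OF component_subgroup])

lemma component_add: "\<lbrakk>i \<in> carrier G; x \<in> B i; y \<in> B i\<rbrakk> \<Longrightarrow> x \<oplus> y \<in> B i"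
  by (rule additive_subgroup.a_closed[OF component_subgroup])

lemma component_minus: "\<lbrakk>i \<in> carrier G; x \<in> B i\<rbrakk> \<Longrightarrow> \<ominus> x \<in> B i"
  by (rule additive_subgroup.a_inv_closed[OF component_subgroup])

lemma component_diff: "\<lbrakk>i \<in> carrier G; x \<in> B i; y \<in> B i\<rbrakk> \<Longrightarrow> x \<ominus> y \<in> B i"
  by (simp add: a_minus_def component_add component_minus)

lemma component_one [simp]: "\<one> \<in> B \<one>\<^bsub>G\<^esub>"
  using ground_degree subringE(3)[OF subfieldE(1)[OF ground_subfield]] by auto

lemma component_pow: "\<lbrakk>i \<in> carrier G; x \<in> B i\<rbrakk> \<Longrightarrow> x [^] (n::nat) \<in> B (i [^]\<^bsub>G\<^esub> n)"
  by (induction n) (auto intro: component_mult)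

lemma component_nat: "[(n::nat)] \<cdot> \<one> \<in> B \<one>\<^bsub>G\<^esub>"
  by (induction n) (auto intro: component_add)

lemma proj_in: "\<lbrakk>i \<in> carrier G; x \<in> carrier R\<rbrakk> \<Longrightarrow> proj i x \<in> B i"
  using proj_spec(1) by (auto simp: PiE_iff)

lemma proj_closed [simp, intro]: "\<lbrakk>i \<in> carrier G; x \<in> carrier R\<rbrakk> \<Longrightarrow> proj i x \<in> carrier R"
  using proj_in component_subset by blast

lemma supp_subset: "supp x \<subseteq> carrier G"
  by (auto simp: supp_def)

lemma proj_unique:
  assumes "finite F" "F \<subseteq> carrier G" "\<And>i. i \<in> F \<Longrightarrow> y i \<in> B i" "j \<in> carrier G"
  shows "proj j (\<Oplus>i\<in>F. y i) = (if j \<in> F then y j else \<zero>)"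
proof -
  \<comment> \<open>Extension by zero turns the family into a candidate for the unique
    decomposition. Some \<open>y i\<close> may vanish, so its support can be smaller than
    \<open>F\<close>.\<close>
  define f where "f = (\<lambda>i\<in>carrier G. if i \<in> F then y i else \<zero>)"
  let ?x = "\<Oplus>i\<in>F. y i"
  let ?P = "\<lambda>f. f \<in> (\<Pi>\<^sub>E i\<in>carrier G. B i) \<and> finite {i \<in> carrier G. f i \<noteq> \<zero>} \<and>
     ?x = finsum R f {i \<in> carrier G. f i \<noteq> \<zero>}"
  have y: "y i \<in> carrier R" if "i \<in> F" for i
    using that assms component_subset by blast
  have sub: "{i \<in> carrier G. f i \<noteq> \<zero>} \<subseteq> F"
    by (auto simp: f_def split: if_splits)
  have "finsum R f {i \<in> carrier G. f i \<noteq> \<zero>} = ?x"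
    using assms(1,2) sub y
    by (intro add.finprod_mono_neutral_cong_left) (auto simp: f_def)
  moreover have "finite {i \<in> carrier G. f i \<noteq> \<zero>}"
    using sub assms(1) finite_subset by blast
  moreover have "f \<in> (\<Pi>\<^sub>E i\<in>carrier G. B i)"
    using assms by (auto simp: f_def)
  ultimately have "?P f" by simp
  moreover have "?x \<in> carrier R"
    using y by auto
  ultimately have "(THE f. ?P f) = f"
    using direct_sum by (intro the1_equality) auto
  then show ?thesis
    using assms(4) by (simp add: proj_def f_def)
qed

lemma finsum_proj:
  assumes "x \<in> carrier R" "finite F" "supp x \<subseteq> F" "F \<subseteq> carrier G"
  shows "x = (\<Oplus>i\<in>F. proj i x)"
proof -
  have "(\<Oplus>i\<in>supp x. proj i x) = (\<Oplus>i\<in>F. proj i x)"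
    using assms by (intro add.finprod_mono_neutral_cong_left) (auto simp: supp_def)
  then show ?thesis
    using proj_spec(3)[OF assms(1)] by simp
qed

lemma proj_add [simp]:
  assumes "x \<in> carrier R" "y \<in> carrier R" "j \<in> carrier G"
  shows "proj j (x \<oplus> y) = proj j x \<oplus> proj j y"
proof -
  define F where "F = insert j (supp x \<union> supp y)"
  have F: "finite F" "F \<subseteq> carrier G" "j \<in> F"
    using proj_spec(2) assms supp_subset by (auto simp: F_def)
  have "x \<oplus> y = (\<Oplus>i\<in>F. proj i x) \<oplus> (\<Oplus>i\<in>F. proj i y)"
    using F(1,2) assms(1,2) by (intro arg_cong2[where f = "add R"] finsum_proj) (auto simp: F_def)
  also have "\<dots> = (\<Oplus>i\<in>F. proj i x \<oplus> proj i y)"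
    using F assms by (intro finsum_addf[symmetric]) auto
  finally have sum: "x \<oplus> y = (\<Oplus>i\<in>F. proj i x \<oplus> proj i y)" .
  have "proj i x \<oplus> proj i y \<in> B i" if "i \<in> F" for i
    using that F(2) assms by (intro component_add proj_in) auto
  then have "proj j (\<Oplus>i\<in>F. proj i x \<oplus> proj i y) = (if j \<in> F then proj j x \<oplus> proj j y else \<zero>)"
    using F(1,2) assms(3) by (intro proj_unique)
  then show ?thesis
    using sum F(3) by simp
qed

lemma proj_homogeneous:
  assumes "i \<in> carrier G" "x \<in> B i" "j \<in> carrier G"
  shows "proj j x = (if j = i then x else \<zero>)"
  using proj_unique[of "{i}" "\<lambda>_. x" j] assms component_subset[of i x] by auto

lemma proj_zero [simp]: "j \<in> carrier G \<Longrightarrow> proj j \<zero> = \<zero>"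
  using proj_homogeneous[of j \<zero> j] by simp

lemma proj_minus [simp]: "\<lbrakk>x \<in> carrier R; j \<in> carrier G\<rbrakk> \<Longrightarrow> proj j (\<ominus> x) = \<ominus> proj j x"
  using proj_add[of x "\<ominus> x" j] by (metis add.inv_closed minus_equality minus_minus proj_closed proj_zero r_neg)

lemma homogeneous_induct [consumes 1, case_names zero add homogeneous]:
  assumes "x \<in> carrier R" "P \<zero>"
    and "\<And>x y. \<lbrakk>x \<in> carrier R; y \<in> carrier R; P x; P y\<rbrakk> \<Longrightarrow> P (x \<oplus> y)"
    and "\<And>i x. \<lbrakk>i \<in> carrier G; x \<in> B i\<rbrakk> \<Longrightarrow> P x"
  shows "P x"
proof -
  have "(\<Oplus>i\<in>supp x. proj i x) \<in> {x \<in> carrier R. P x}"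
  proof (rule finsum_closed_under)
    fix i assume "i \<in> supp x"
    then have "i \<in> carrier G"
      using supp_subset by blast
    then show "proj i x \<in> {x \<in> carrier R. P x}"
      using assms(4)[of i "proj i x"] proj_in assms(1) by simp
  qed (use assms(2,3) in auto)
  then show ?thesis
    using proj_spec(3)[OF assms(1)] by simp
qed

lemma eq_zero_proj: "\<lbrakk>x \<in> carrier R; \<And>i. i \<in> carrier G \<Longrightarrow> proj i x = \<zero>\<rbrakk> \<Longrightarrow> x = \<zero>"
  using finsum_proj[of x "{}"] unfolding supp_def by force

text \<open>Both sides are additive in \<open>x\<close>, so homogeneous elements suffice. The lemma
  serves multiplication by a homogeneous element as well as homogeneous derivations.\<close>

lemma proj_graded_map:
  assumes x: "x \<in> carrier R" and ij: "i \<in> carrier G" "j \<in> carrier G"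
    and closed: "\<And>x. x \<in> carrier R \<Longrightarrow> f x \<in> carrier R"
    and add: "\<And>x y. \<lbrakk>x \<in> carrier R; y \<in> carrier R\<rbrakk> \<Longrightarrow> f (x \<oplus> y) = f x \<oplus> f y"
    and degree: "\<And>k x. \<lbrakk>k \<in> carrier G; x \<in> B k\<rbrakk> \<Longrightarrow> f x \<in> B (k \<otimes>\<^bsub>G\<^esub> j)"
  shows "proj (i \<otimes>\<^bsub>G\<^esub> j) (f x) = f (proj i x)"
proof -
  have "f \<zero> \<oplus> f \<zero> = f \<zero>"
    using add[of \<zero> \<zero>] by simp
  then have f_zero: "f \<zero> = \<zero>"
    using add.l_cancel_one[of "f \<zero>" "f \<zero>"] closed by simp
  show ?thesis
    using x
  proof (induction x rule: homogeneous_induct)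
    case zero
    show ?case
      using ij f_zero by simp
  next
    case (add x y)
    then show ?case
      using ij closed assms(5) by simp
  next
    case (homogeneous k x)
    then show ?case
      using f_zero homogeneous ij degree[OF homogeneous]
        proj_homogeneous[of "k \<otimes>\<^bsub>G\<^esub> j" "f x" "i \<otimes>\<^bsub>G\<^esub> j"]
      by (simp add: proj_homogeneous)
  qed
qed

lemma proj_mult_homogeneous:
  assumes "i \<in> carrier G" "j \<in> carrier G" "u \<in> B j" "x \<in> carrier R"
  shows "proj (i \<otimes>\<^bsub>G\<^esub> j) (u \<otimes> x) = u \<otimes> proj i x"
proof -
  have u: "u \<in> carrier R"
    using assms component_subset by blast
  show ?thesis
  proof (rule proj_graded_map)
    fix k y assume "k \<in> carrier G" "y \<in> B k"
    then show "u \<otimes> y \<in> B (k \<otimes>\<^bsub>G\<^esub> j)"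
      using component_mult[of j k u y] assms by (simp add: G.m_comm)
  qed (use assms u in \<open>auto simp: r_distr\<close>)
qed

text \<open>Multiplication by \<open>u\<close> only shifts degrees, so \<open>u \<otimes> x\<close>
  equals \<open>u \<otimes> proj i x\<close>, and \<open>u\<close> cancels. This is how the degree
  of a quotient is found.\<close>

lemma component_quotient:
  assumes "i \<in> carrier G" "j \<in> carrier G" "u \<in> B j" "u \<noteq> \<zero>" "x \<in> carrier R"
    and "u \<otimes> x \<in> B (i \<otimes>\<^bsub>G\<^esub> j)"
  shows "x \<in> B i"
proof -
  have u: "u \<in> carrier R"
    using assms component_subset by blast
  have "u \<otimes> x = u \<otimes> proj i x"
    using assms proj_mult_homogeneous[of i j u x] proj_homogeneous[of "i \<otimes>\<^bsub>G\<^esub> j" "u \<otimes> x" "i \<otimes>\<^bsub>G\<^esub> j"]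
    by simp
  then have "x = proj i x"
    using m_lcancel u assms by auto
  then show ?thesis
    using proj_in assms by metis
qed

text \<open>Generation as a ring passes through inhomogeneous elements, so the induction shows
  instead that every component \<open>proj j x\<close> lies in \<open>Q j\<close>. Two instances
  follow: \<open>Q j\<close> as the span of the monomials of degree \<open>j\<close>, and
  \<open>Q j\<close> as a bound on the degrees occurring in \<open>D x\<close>.\<close>

lemma graded_induct:
  assumes generates: "generate_ring R (K \<union> S) = carrier R"
    and generators: "\<And>b. b \<in> S \<Longrightarrow> \<delta> b \<in> carrier G \<and> b \<in> B (\<delta> b) \<and> b \<in> Q (\<delta> b)"
    and ground: "K \<subseteq> Q \<one>\<^bsub>G\<^esub>"
    and subgroup: "\<And>j. j \<in> carrier G \<Longrightarrow> additive_subgroup (Q j) R"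
    and mult: "\<And>i j x y. \<lbrakk>i \<in> carrier G; j \<in> carrier G; x \<in> B i; x \<in> Q i; y \<in> B j; y \<in> Q j\<rbrakk>
      \<Longrightarrow> x \<otimes> y \<in> Q (i \<otimes>\<^bsub>G\<^esub> j)"
    and x: "j \<in> carrier G" "x \<in> B j"
  shows "x \<in> Q j"
proof -
  define V where "V = {x \<in> carrier R. \<forall>j\<in>carrier G. proj j x \<in> Q j}"
  have Q_zero: "\<zero> \<in> Q j" if "j \<in> carrier G" for j
    using additive_subgroup.zero_closed[OF subgroup[OF that]] .
  have V_homogeneous: "x \<in> V" if "i \<in> carrier G" "x \<in> B i" "x \<in> Q i" for i x
    using that component_subset[of i x] by (auto simp: V_def proj_homogeneous Q_zero)
  have V_add: "x \<oplus> y \<in> V" if "x \<in> V" "y \<in> V" for x y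
    using that additive_subgroup.a_closed[OF subgroup] by (auto simp: V_def)
  have V_zero: "\<zero> \<in> V"
    by (auto simp: V_def Q_zero)
  have "generate_ring R (K \<union> S) \<subseteq> V"
  proof
    fix x assume "x \<in> generate_ring R (K \<union> S)"
    then show "x \<in> V"
    proof induction
      case one
      then show ?case
        using ground V_homogeneous[of "\<one>\<^bsub>G\<^esub>" \<one>] subringE(3)[OF subfieldE(1)[OF ground_subfield]]
        by auto
    next
      case (incl h)
      then show ?case
        using ground ground_degree generators V_homogeneous G.one_closed by blast
    next
      case (a_inv h)
      then show ?case
        using additive_subgroup.a_inv_closed[OF subgroup]
        by (auto simp: V_def)
    next
      case (eng_add h1 h2)
      then show ?case using V_add by blast
    next
      case (eng_mult x y)
      have y: "y \<in> carrier R" and x: "x \<in> carrier R"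
        using eng_mult by (auto simp: V_def)
      \<comment> \<open>If the left factor is homogeneous of degree \<open>i\<close>, the component
        of the product in degree \<open>j\<close> is \<open>u\<close> times the single component of
        \<open>y\<close> in degree \<open>j - i\<close>. A general left factor is then the sum of
        its components.\<close>
      have u: "u \<otimes> y \<in> V" if "i \<in> carrier G" "u \<in> B i" "u \<in> Q i" for i u
      proof -
        have uR: "u \<in> carrier R"
          using that component_subset by blast
        have "proj j (u \<otimes> y) \<in> Q j" if j: "j \<in> carrier G" for j
        proof -
          let ?k = "j \<otimes>\<^bsub>G\<^esub> inv\<^bsub>G\<^esub> i"
          have k: "?k \<in> carrier G" "?k \<otimes>\<^bsub>G\<^esub> i = j" "i \<otimes>\<^bsub>G\<^esub> ?k = j"
            using \<open>i \<in> carrier G\<close> j G.m_comm[of i ?k] by (simp_all add: G.m_assoc)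
          have "proj j (u \<otimes> y) = u \<otimes> proj ?k y"
            using proj_mult_homogeneous[of ?k i u y] k that \<open>i \<in> carrier G\<close> \<open>u \<in> B i\<close> y by simp
          moreover have "proj ?k y \<in> B ?k" "proj ?k y \<in> Q ?k"
            using eng_mult k(1) y by (auto simp: V_def intro: proj_in)
          then have "u \<otimes> proj ?k y \<in> Q j"
            using mult[of i ?k u "proj ?k y"] k \<open>i \<in> carrier G\<close> \<open>u \<in> B i\<close> \<open>u \<in> Q i\<close> by simp
          ultimately show ?thesis by simp
        qed
        then show ?thesis
          using uR y by (auto simp: V_def)
      qed
      have "x \<otimes> y = (\<Oplus>i\<in>supp x. proj i x) \<otimes> y"
        using proj_spec(3)[OF x] by simp
      also have "\<dots> = (\<Oplus>i\<in>supp x. proj i x \<otimes> y)"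
        using proj_spec(2)[OF x] supp_subset x y by (intro finsum_ldistr) auto
      also have "\<dots> \<in> V"
      proof (rule finsum_closed_under)
        fix i assume "i \<in> supp x"
        then have i: "i \<in> carrier G"
          using supp_subset by auto
        then have "proj i x \<in> Q i"
          using eng_mult by (auto simp: V_def)
        then show "proj i x \<otimes> y \<in> V"
          using u i proj_in x by blast
      qed (use V_zero V_add in \<open>auto simp: V_def\<close>)
      finally show ?case .
    qed
  qed
  moreover have xR: "x \<in> carrier R"
    using x component_subset by blast
  ultimately have "proj j x \<in> Q j"
    using generates x(1) by (auto simp: V_def)
  then show ?thesis
    using x by (simp add: proj_homogeneous)
qed

text \<open>The new generators are the nonzero homogeneous components of the old ones.\<close>

lemma homogeneous_generators:
  assumes "finite S" "S \<subseteq> carrier R" "generate_ring R (K \<union> S) = carrier R"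
  obtains S' \<delta> where "finite S'" "generate_ring R (K \<union> S') = carrier R"
    and "\<And>b. b \<in> S' \<Longrightarrow> \<delta> b \<in> carrier G \<and> b \<in> B (\<delta> b) \<and> b \<noteq> \<zero>"
proof -
  define S' where "S' = (\<Union>x\<in>S. (\<lambda>i. proj i x) ` supp x)"
  have K: "K \<subseteq> carrier R"
    using subringE(1)[OF subfieldE(1)[OF ground_subfield]] .
  have fin: "finite S'"
    using assms proj_spec(2) by (auto simp: S'_def)
  have S': "\<exists>i. i \<in> carrier G \<and> b \<in> B i \<and> b \<noteq> \<zero>" if "b \<in> S'" for b
    using that assms(2) by (auto simp: S'_def supp_def intro: proj_in)
  have "S' \<subseteq> carrier R"
    using S' component_subset by blast
  let ?V = "generate_ring R (K \<union> S')"
  have V: "?V \<subseteq> carrier R"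
    using K \<open>S' \<subseteq> carrier R\<close> generate_ring_in_carrier[of "K \<union> S'"] by auto
  have zero: "\<zero> \<in> ?V"
    using subringE(2)[OF subfieldE(1)[OF ground_subfield]] by (intro generate_ring.incl) auto
  have "S \<subseteq> ?V"
  proof
    fix x assume x: "x \<in> S"
    have "(\<Oplus>i\<in>supp x. proj i x) \<in> ?V"
      using x V zero
      by (intro finsum_closed_under) (auto intro: generate_ring.incl generate_ring.eng_add simp: S'_def)
    then show "x \<in> ?V"
      using proj_spec(3)[of x] x assms(2) by auto
  qed
  have "x \<in> ?V" if "x \<in> generate_ring R (K \<union> S)" for x
    using that
  proof induction
    case (incl h)
    then show ?case
      using \<open>S \<subseteq> ?V\<close> by (auto intro: generate_ring.incl)
  qed (auto intro: generate_ring.intros)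
  then have "?V = carrier R"
    using V assms(3) by blast
  moreover obtain \<delta> where "\<forall>b\<in>S'. \<delta> b \<in> carrier G \<and> b \<in> B (\<delta> b) \<and> b \<noteq> \<zero>"
    using bchoice[of S' "\<lambda>b i. i \<in> carrier G \<and> b \<in> B i \<and> b \<noteq> \<zero>"] S' by blast
  ultimately show thesis
    using that[of S' \<delta>] fin by blast
qed

end

subsection \<open>Veronese subrings\<close>

text \<open>Membership of \<open>H\<close> in \<open>cotorsion_subgroups G R B\<close> enters
  through the assumption \<open>torsion\<close>, a statement on single degrees;
  \<open>support_torsion\<close> derives it from the factor group.\<close>

locale cotorsion_graded_algebra = graded_algebra R G B K for R (structure) and G and B and K +
  fixes H
  assumes subgroup: "subgroup H G"
    and torsion: "\<lbrakk>j \<in> carrier G; x \<in> B j; x \<noteq> \<zero>\<rbrakk> \<Longrightarrow> \<exists>n>0. j [^]\<^bsub>G\<^esub> (n::nat) \<in> H"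
begin

lemma H_carrier: "i \<in> H \<Longrightarrow> i \<in> carrier G"
  using subgroup.mem_carrier[OF subgroup] .

lemma H_mult: "\<lbrakk>i \<in> H; j \<in> H\<rbrakk> \<Longrightarrow> i \<otimes>\<^bsub>G\<^esub> j \<in> H"
  using subgroup.m_closed[OF subgroup] .

lemma H_one: "\<one>\<^bsub>G\<^esub> \<in> H"
  using subgroup.one_closed[OF subgroup] .

lemma H_inv: "i \<in> H \<Longrightarrow> inv\<^bsub>G\<^esub> i \<in> H"
  using subgroup.m_inv_closed[OF subgroup] .

lemma H_pow: "i \<in> H \<Longrightarrow> i [^]\<^bsub>G\<^esub> (n::nat) \<in> H"
  by (induction n) (auto simp: H_one H_mult)

lemma H_cancel: "\<lbrakk>i \<in> H; j \<in> carrier G; i \<otimes>\<^bsub>G\<^esub> j \<in> H\<rbrakk> \<Longrightarrow> j \<in> H"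
  using H_mult[OF H_inv, of i "i \<otimes>\<^bsub>G\<^esub> j"] H_carrier by (simp add: G.m_assoc[symmetric])

text \<open>The family in the definition of \<open>veronese\<close> must consist of the projections
  of \<open>x\<close>, by uniqueness of the decomposition. The assumption on \<open>\<zero>\<close>
  covers the degrees in which \<open>x\<close> has no component.\<close>

lemma veronese_iff:
  assumes "\<zero> \<in> A"
  shows "x \<in> veronese R B H A \<longleftrightarrow>
    x \<in> carrier R \<and> (\<forall>i\<in>carrier G. proj i x \<in> A \<and> (i \<notin> H \<longrightarrow> proj i x = \<zero>))"
proof
  assume "x \<in> veronese R B H A"
  then obtain f where f: "f \<in> (\<Pi>\<^sub>E i\<in>H. A \<inter> B i)" "finite {i \<in> H. f i \<noteq> \<zero>}"
    "x = finsum R f {i \<in> H. f i \<noteq> \<zero>}"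
    by (auto simp: veronese_def)
  have fB: "f i \<in> B i" "f i \<in> A" if "i \<in> H" for i
    using f(1) that by (auto simp: PiE_iff)
  have "x \<in> carrier R"
    unfolding f(3) using fB H_carrier component_subset by (intro finsum_closed) blast
  moreover have "proj i x = (if i \<in> {i \<in> H. f i \<noteq> \<zero>} then f i else \<zero>)" if "i \<in> carrier G" for i
    unfolding f(3) using f(2) fB H_carrier that by (intro proj_unique) auto
  ultimately show "x \<in> carrier R \<and> (\<forall>i\<in>carrier G. proj i x \<in> A \<and> (i \<notin> H \<longrightarrow> proj i x = \<zero>))"
    using fB assms by auto
next
  assume x: "x \<in> carrier R \<and> (\<forall>i\<in>carrier G. proj i x \<in> A \<and> (i \<notin> H \<longrightarrow> proj i x = \<zero>))"
  define f where "f = (\<lambda>i\<in>H. proj i x)"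
  have eq: "{i \<in> H. f i \<noteq> \<zero>} = supp x"
    using x H_carrier by (auto simp: f_def supp_def)
  have "f \<in> (\<Pi>\<^sub>E i\<in>H. A \<inter> B i)"
    using x H_carrier proj_in by (auto simp: f_def)
  moreover have "finsum R f (supp x) = (\<Oplus>i\<in>supp x. proj i x)"
    using x H_carrier by (intro finsum_cong') (auto simp: f_def supp_def)
  then have "x = finsum R f (supp x)"
    using x proj_spec(3)[of x] by simp
  ultimately show "x \<in> veronese R B H A"
    unfolding veronese_def mem_Collect_eq using x proj_spec(2)[of x] by (intro bexI[of _ f]) (simp_all only: eq)
qed

abbreviation "V \<equiv> veronese R B H (carrier R)"

lemma V_iff: "x \<in> V \<longleftrightarrow> x \<in> carrier R \<and> (\<forall>i\<in>carrier G. i \<notin> H \<longrightarrow> proj i x = \<zero>)"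
  by (auto simp: veronese_iff)

lemma V_closed: "x \<in> V \<Longrightarrow> x \<in> carrier R"
  by (simp add: V_iff)

lemma V_zero: "\<zero> \<in> V"
  by (simp add: V_iff)

lemma V_add: "\<lbrakk>x \<in> V; y \<in> V\<rbrakk> \<Longrightarrow> x \<oplus> y \<in> V"
  by (simp add: V_iff)

lemma V_homogeneous: "\<lbrakk>i \<in> H; x \<in> B i\<rbrakk> \<Longrightarrow> x \<in> V"
  using H_carrier[of i] component_subset[of i x] by (auto simp: V_iff proj_homogeneous[of i])

lemma V_induct [consumes 1, case_names zero add homogeneous]:
  assumes "x \<in> V" "P \<zero>"
    and "\<And>x y. \<lbrakk>x \<in> V; y \<in> V; P x; P y\<rbrakk> \<Longrightarrow> P (x \<oplus> y)"
    and "\<And>i x. \<lbrakk>i \<in> H; x \<in> B i\<rbrakk> \<Longrightarrow> P x"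
  shows "P x"
proof -
  have "(\<Oplus>i\<in>supp x. proj i x) \<in> {x \<in> V. P x}"
  proof (rule finsum_closed_under)
    fix i assume "i \<in> supp x"
    then have "i \<in> H" "i \<in> carrier G"
      using assms(1) by (auto simp: V_iff supp_def)
    then show "proj i x \<in> {x \<in> V. P x}"
      using assms(4)[of i "proj i x"] proj_in assms(1) V_homogeneous V_closed by simp
  qed (use assms(2,3) V_zero V_add V_closed in auto)
  then show ?thesis
    using proj_spec(3)[of x] V_closed[OF assms(1)] by simp
qed

lemma V_mult:
  assumes "x \<in> V" "y \<in> V"
  shows "x \<otimes> y \<in> V"
  using assms(1)
proof (induction x rule: V_induct)
  case zero
  then show ?case
    using assms V_closed V_zero by simp
next
  case (add u v)
  then show ?case
    using assms(2) V_closed V_add by (simp add: l_distr)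
next
  case (homogeneous i u)
  show ?case
    using assms(2)
  proof (induction y rule: V_induct)
    case zero
    then show ?case
      using component_subset[OF H_carrier[OF homogeneous(1)] homogeneous(2)] V_zero by simp
  next
    case (add y z)
    then show ?case
      using component_subset[OF H_carrier[OF homogeneous(1)] homogeneous(2)] V_closed V_add
      by (simp add: r_distr)
  next
    case (homogeneous j y)
    then show ?case
      using \<open>i \<in> H\<close> \<open>u \<in> B i\<close> H_carrier V_homogeneous[OF H_mult[of i j]] component_mult[of i j u y] by simp
  qed
qed

lemma V_pow_torsion:
  assumes "i \<in> carrier G" "x \<in> B i"
  obtains n where "n > 0" "x [^] (n::nat) \<in> V"
proof (cases "x = \<zero>")
  case True
  then show thesis
    using that[of 1] V_zero by simp
next
  case False
  then obtain n where "n > 0" "i [^]\<^bsub>G\<^esub> (n::nat) \<in> H"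
    using torsion assms by blast
  then show thesis
    using that V_homogeneous component_pow assms by blast
qed

text \<open>The generators are the powers \<open>b [^] M b\<close> of the homogeneous generators \<open>b\<close> of the
  ring, where \<open>M b\<close> times the degree of \<open>b\<close> lies in \<open>H\<close>, and the finitely many monomials of degree in
  \<open>H\<close> with all exponents below \<open>M\<close>.\<close>

lemma veronese_finitely_generated:
  assumes "finite S0" "S0 \<subseteq> carrier R" "generate_ring R (K \<union> S0) = carrier R"
  obtains F where "finite F" "\<And>x. x \<in> F \<Longrightarrow> \<exists>i\<in>H. x \<in> B i" "V \<subseteq> generate_ring R (K \<union> F)"
proof -
  have K: "K \<subseteq> carrier R"
    using subringE(1)[OF subfieldE(1)[OF ground_subfield]] .
  obtain S \<delta> where S: "finite S" "generate_ring R (K \<union> S) = carrier R"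
    and \<delta>: "\<And>b. b \<in> S \<Longrightarrow> \<delta> b \<in> carrier G \<and> b \<in> B (\<delta> b) \<and> b \<noteq> \<zero>"
    using homogeneous_generators[OF assms] by metis
  have SR: "b \<in> carrier R" if "b \<in> S" for b
    using \<delta>[OF that] component_subset by blast
  have "\<forall>b\<in>S. \<exists>n>0. \<delta> b [^]\<^bsub>G\<^esub> (n::nat) \<in> H"
    using torsion \<delta> by blast
  then obtain M where M: "\<And>b. b \<in> S \<Longrightarrow> M b > 0 \<and> \<delta> b [^]\<^bsub>G\<^esub> (M b :: nat) \<in> H"
    by metis
  define mono where "mono n = (\<Otimes>b\<in>S. b [^] (n b :: nat))" for n
  define deg where "deg n = (\<Otimes>\<^bsub>G\<^esub>b\<in>S. \<delta> b [^]\<^bsub>G\<^esub> (n b :: nat))" for n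
  have monoR: "mono n \<in> carrier R" for n
    using SR by (auto simp: mono_def)
  have degG: "deg n \<in> carrier G" for n
    using \<delta> by (auto simp: deg_def)
  have mono_add: "mono (\<lambda>b. n b + m b) = mono n \<otimes> mono m" for n m
  proof -
    have "mono (\<lambda>b. n b + m b) = (\<Otimes>b\<in>S. b [^] n b \<otimes> b [^] m b)"
      unfolding mono_def using SR by (intro finprod_cong') (auto simp: nat_pow_mult)
    then show ?thesis
      using SR by (simp add: mono_def finprod_multf)
  qed
  have deg_add: "deg (\<lambda>b. n b + m b) = deg n \<otimes>\<^bsub>G\<^esub> deg m" for n m
  proof -
    have "deg (\<lambda>b. n b + m b) = (\<Otimes>\<^bsub>G\<^esub>b\<in>S. \<delta> b [^]\<^bsub>G\<^esub> n b \<otimes>\<^bsub>G\<^esub> \<delta> b [^]\<^bsub>G\<^esub> m b)"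
      unfolding deg_def using \<delta> by (intro G.finprod_cong') (auto simp: G.nat_pow_mult)
    then show ?thesis
      using \<delta> by (simp add: deg_def G.finprod_multf)
  qed
  have mono_degree: "mono n \<in> B (deg n)" for n
  proof -
    have "(\<Otimes>b\<in>T. b [^] n b) \<in> B (\<Otimes>\<^bsub>G\<^esub>b\<in>T. \<delta> b [^]\<^bsub>G\<^esub> n b)" if "finite T" "T \<subseteq> S" for T
      using that
    proof (induction T)
      case (insert b T)
      then have b: "b \<in> S" by simp
      have "(\<Otimes>c\<in>insert b T. c [^] n c) = b [^] n b \<otimes> (\<Otimes>c\<in>T. c [^] n c)"
        using insert SR by (intro finprod_insert) auto
      moreover have "(\<Otimes>\<^bsub>G\<^esub>c\<in>insert b T. \<delta> c [^]\<^bsub>G\<^esub> n c) =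
          \<delta> b [^]\<^bsub>G\<^esub> n b \<otimes>\<^bsub>G\<^esub> (\<Otimes>\<^bsub>G\<^esub>c\<in>T. \<delta> c [^]\<^bsub>G\<^esub> n c)"
        using insert \<delta> by (intro G.finprod_insert) auto
      moreover have "(\<Otimes>\<^bsub>G\<^esub>c\<in>T. \<delta> c [^]\<^bsub>G\<^esub> n c) \<in> carrier G"
        using insert \<delta> by (intro G.finprod_closed) auto
      ultimately show ?case
        using insert \<delta>[OF b] by (auto intro!: component_mult component_pow)
    qed simp
    then show ?thesis
      using S(1) by (simp add: mono_def deg_def)
  qed
  define F1 where "F1 = (\<lambda>b. b [^] M b) ` S"
  define F2 where "F2 = mono ` {r \<in> (\<Pi>\<^sub>E b\<in>S. {..<M b}). deg r \<in> H}"
  let ?A = "generate_ring R (K \<union> (F1 \<union> F2))"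
  have "finite (F1 \<union> F2)"
    using S(1) finite_PiE[of S "\<lambda>b. {..<M b}"] by (auto simp: F1_def F2_def)
  moreover have F_degree: "\<exists>i\<in>H. x \<in> B i" if "x \<in> F1 \<union> F2" for x
    using that mono_degree M \<delta> component_pow unfolding F1_def F2_def by blast
  moreover have "V \<subseteq> ?A"
  proof -
    have "F1 \<union> F2 \<subseteq> carrier R"
      using F_degree H_carrier component_subset by blast
    then have AR: "?A \<subseteq> carrier R"
      using K generate_ring_in_carrier[of "K \<union> (F1 \<union> F2)"] by blast
    have A_zero: "\<zero> \<in> ?A"
      using subringE(2)[OF subfieldE(1)[OF ground_subfield]] by (intro generate_ring.incl) auto
    have A_pow: "x [^] (n::nat) \<in> ?A" if "x \<in> ?A" for x n
      using that by (induction n) (auto intro: generate_ring.intros)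
    \<comment> \<open>Each exponent is divided by \<open>M b\<close> with remainder. The quotient
      part is a product of powers of elements of \<open>F1\<close> and has degree in
      \<open>H\<close>, so the remainder monomial also has degree in \<open>H\<close> and belongs to
      \<open>F2\<close>.\<close>
    have reduce: "mono n \<in> ?A" if "deg n \<in> H" for n
    proof -
      define q where "q b = M b * (n b div M b)" for b
      \<comment> \<open>The restriction to \<open>S\<close> places \<open>r\<close> in the finite
        set of extensional exponent vectors that indexes \<open>F2\<close>.\<close>
      define r where "r = (\<lambda>b\<in>S. n b mod M b)"
      have n: "n b = q b + r b" if "b \<in> S" for b
        using that by (simp add: q_def r_def)
      have "mono n = mono (\<lambda>b. q b + r b)"
        unfolding mono_def using n SR by (intro finprod_cong') auto
      then have mono_n: "mono n = mono q \<otimes> mono r"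
        by (simp add: mono_add)
      have "deg n = deg (\<lambda>b. q b + r b)"
        unfolding deg_def using n \<delta> by (intro G.finprod_cong') auto
      then have deg_n: "deg n = deg q \<otimes>\<^bsub>G\<^esub> deg r"
        by (simp add: deg_add)
      have "deg q \<in> H"
        unfolding deg_def
      proof (rule G.finprod_closed_under)
        fix b assume b: "b \<in> S"
        then have "\<delta> b [^]\<^bsub>G\<^esub> q b = (\<delta> b [^]\<^bsub>G\<^esub> M b) [^]\<^bsub>G\<^esub> (n b div M b)"
          using \<delta> by (simp add: q_def G.nat_pow_pow)
        then show "\<delta> b [^]\<^bsub>G\<^esub> q b \<in> H"
          using M[OF b] H_pow by simp
      qed (use H_one H_mult H_carrier in auto)
      then have "deg r \<in> H"
        using that deg_n degG H_cancel by metis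
      moreover have "r \<in> (\<Pi>\<^sub>E b\<in>S. {..<M b})"
        using M by (auto simp: r_def)
      ultimately have "mono r \<in> ?A"
        by (intro generate_ring.incl) (auto simp: F2_def)
      moreover have "mono q \<in> ?A"
        unfolding mono_def
      proof (rule finprod_closed_under)
        fix b assume b: "b \<in> S"
        then have "b [^] q b = (b [^] M b) [^] (n b div M b)"
          using SR by (simp add: q_def nat_pow_pow)
        moreover have "b [^] M b \<in> ?A"
          using b by (intro generate_ring.incl) (auto simp: F1_def)
        ultimately show "b [^] q b \<in> ?A"
          using A_pow by simp
      qed (use AR in \<open>auto intro: generate_ring.intros\<close>)
      ultimately show ?thesis
        unfolding mono_n by (intro generate_ring.eng_mult)
    qed
    define gens where "gens j = {k \<otimes> mono n | k n. k \<in> K \<and> deg n = j}" for j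
    have gensR: "gens j \<subseteq> carrier R" for j
      using K monoR by (auto simp: gens_def)
    have gens_mult: "x \<otimes> y \<in> gens (i \<otimes>\<^bsub>G\<^esub> j)" if xy: "x \<in> gens i" "y \<in> gens j" for x y i j
    proof -
      obtain k n where x: "x = k \<otimes> mono n" "k \<in> K" "deg n = i"
        using xy(1) by (auto simp: gens_def)
      obtain l m where y: "y = l \<otimes> mono m" "l \<in> K" "deg m = j"
        using xy(2) by (auto simp: gens_def)
      have "x \<otimes> y = (k \<otimes> l) \<otimes> mono (\<lambda>b. n b + m b)"
        using x y K monoR by (simp add: mono_add m_ac subset_iff)
      then show ?thesis
        using x y subringE(6)[OF subfieldE(1)[OF ground_subfield], of k l] deg_add[of n m]
        unfolding gens_def by blast
    qed
    \<comment> \<open>The additive span of the scalar multiples of monomials of formal degree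
      \<open>j\<close>. \<open>graded_induct\<close> will show that it contains all of
      \<open>B j\<close>.\<close>
    define Q where "Q j = generate (add_monoid R) (gens j)" for j
    have Q_subgroup: "additive_subgroup (Q j) R" for j
      unfolding Q_def using gensR by (intro additive_subgroup.intro add.generate_is_subgroup) auto
    have Q_min: "x \<in> W" if "x \<in> Q j" "gens j \<subseteq> W" "additive_subgroup W R" for x j W
      using that add.generate_subgroup_incl[of "gens j" W]
      unfolding Q_def additive_subgroup_def by blast
    have Q_gens: "x \<in> Q j" if "x \<in> gens j" for x j
      using that generate.incl[of x "gens j"] by (simp add: Q_def)
    have QR: "x \<in> carrier R" if "x \<in> Q j" for x j
      using that additive_subgroup.a_subset[OF Q_subgroup] by blast
    \<comment> \<open>Minimality of an additive span is applied once in each factor to extend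
      \<open>gens_mult\<close> from the monomial terms to their spans; these preimages are the
      subgroups it is applied to.\<close>
    have preimage: "additive_subgroup {x \<in> carrier R. x \<otimes> y \<in> Q j} R" if "y \<in> carrier R" for y j
      using that additive_subgroup.a_closed[OF Q_subgroup] additive_subgroup.zero_closed[OF Q_subgroup]
        additive_subgroup.a_inv_closed[OF Q_subgroup]
      by (intro additive_subgroup.intro add.subgroupI) (auto simp: l_distr l_minus)
    have Q_mult: "x \<otimes> y \<in> Q (i \<otimes>\<^bsub>G\<^esub> j)" if "x \<in> Q i" "y \<in> Q j" for x y i j
    proof -
      have 1: "x \<otimes> z \<in> Q (i \<otimes>\<^bsub>G\<^esub> j)" if z: "z \<in> gens j" for z
        using Q_min[OF \<open>x \<in> Q i\<close> _ preimage[of z "i \<otimes>\<^bsub>G\<^esub> j"]] z gensR gens_mult Q_gens by blast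
      have "gens j \<subseteq> {z \<in> carrier R. z \<otimes> x \<in> Q (i \<otimes>\<^bsub>G\<^esub> j)}"
        using 1 QR[OF \<open>x \<in> Q i\<close>] gensR[of j] m_comm[of x] by (auto simp: subset_iff)
      then have "y \<in> {z \<in> carrier R. z \<otimes> x \<in> Q (i \<otimes>\<^bsub>G\<^esub> j)}"
        using Q_min[OF \<open>y \<in> Q j\<close> _ preimage[of x]] QR[OF \<open>x \<in> Q i\<close>] by blast
      then show ?thesis
        using m_comm QR[OF \<open>x \<in> Q i\<close>] by auto
    qed
    have K_gens: "k \<in> Q \<one>\<^bsub>G\<^esub>" if "k \<in> K" for k
    proof -
      have "k = k \<otimes> mono (\<lambda>_. 0)" "deg (\<lambda>_. 0) = \<one>\<^bsub>G\<^esub>"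
        using that K by (auto simp: mono_def deg_def)
      then show ?thesis
        using that by (intro Q_gens) (auto simp: gens_def)
    qed
    have S_gens: "b \<in> Q (\<delta> b)" if b: "b \<in> S" for b
    proof -
      let ?n = "\<lambda>c. if c = b then 1 else 0 :: nat"
      have "mono ?n = (\<Otimes>c\<in>S. if b = c then c else \<one>)"
        unfolding mono_def using SR by (intro finprod_cong') auto
      also have "\<dots> = b"
        using b S(1) SR by (intro finprod_singleton) auto
      finally have "b = \<one> \<otimes> mono ?n"
        using SR[OF b] by simp
      moreover have "deg ?n = (\<Otimes>\<^bsub>G\<^esub>c\<in>S. if b = c then \<delta> c else \<one>\<^bsub>G\<^esub>)"
        unfolding deg_def using \<delta> by (intro G.finprod_cong') auto
      then have "deg ?n = \<delta> b"
        using G.finprod_singleton[OF b S(1), of \<delta>] \<delta> by auto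
      ultimately show ?thesis
        using subringE(3)[OF subfieldE(1)[OF ground_subfield]]
        by (intro Q_gens) (unfold gens_def, blast)
    qed
    have homogeneous: "x \<in> ?A" if "j \<in> H" "x \<in> B j" for j x
    proof -
      have "x \<in> Q j"
      proof (rule graded_induct[where \<delta> = \<delta> and S = S])
        fix b assume "b \<in> S"
        then show "\<delta> b \<in> carrier G \<and> b \<in> B (\<delta> b) \<and> b \<in> Q (\<delta> b)"
          using \<delta> S_gens by blast
      qed (use S(2) K_gens Q_subgroup Q_mult that H_carrier in auto)
      moreover have "gens j \<subseteq> ?A"
        using reduce \<open>j \<in> H\<close> by (auto simp: gens_def intro: generate_ring.intros)
      moreover have "additive_subgroup ?A R"
        using AR A_zero
        by (intro additive_subgroup.intro add.subgroupI) (auto intro: generate_ring.intros)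
      ultimately show ?thesis
        using Q_min by blast
    qed
    show ?thesis
    proof
      fix x assume "x \<in> V"
      then show "x \<in> ?A"
        by (induction x rule: V_induct) (auto intro: A_zero homogeneous generate_ring.eng_add)
    qed
  qed
  ultimately show thesis
    using that by blast
qed

end

subsection \<open>Homogeneous locally nilpotent derivations and slices\<close>

locale homogeneous_lnd = cotorsion_graded_algebra R G B K H + lnd_domain R D
  for R (structure) and G and B and K and H and D +
  fixes d
  assumes d_carrier: "d \<in> carrier G"
    and D_degree: "\<lbrakk>i \<in> carrier G; x \<in> B i\<rbrakk> \<Longrightarrow> D x \<in> B (i \<otimes>\<^bsub>G\<^esub> d)"
begin

lemma proj_D: "\<lbrakk>i \<in> carrier G; x \<in> carrier R\<rbrakk> \<Longrightarrow> proj (i \<otimes>\<^bsub>G\<^esub> d) (D x) = D (proj i x)"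
  using proj_graded_map[of x i d D] d_carrier D_degree by simp

lemma iter_degree:
  "\<lbrakk>i \<in> carrier G; x \<in> B i\<rbrakk> \<Longrightarrow> (D ^^ n) x \<in> B (i \<otimes>\<^bsub>G\<^esub> d [^]\<^bsub>G\<^esub> n)"
proof (induction n)
  case (Suc n)
  then have "D ((D ^^ n) x) \<in> B (i \<otimes>\<^bsub>G\<^esub> d [^]\<^bsub>G\<^esub> n \<otimes>\<^bsub>G\<^esub> d)"
    using d_carrier by (intro D_degree) auto
  then show ?case
    using Suc.prems d_carrier by (simp add: G.m_assoc)
qed simp

lemma D_proj_kernel: "\<lbrakk>x \<in> carrier R; D x = \<zero>; i \<in> carrier G\<rbrakk> \<Longrightarrow> D (proj i x) = \<zero>"
  using proj_D[of i x] d_carrier by simp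

text \<open>Every homogeneous element has a power in \<open>V\<close>, and \<open>D_root\<close>
  descends from the power to the element. In contrapositive form: a nonzero \<open>D\<close> remains
  nonzero on \<open>V\<close>.\<close>

lemma D_vanishes_on_veronese:
  assumes "\<And>x. x \<in> V \<Longrightarrow> D x = \<zero>" "x \<in> carrier R"
  shows "D x = \<zero>"
  using assms(2)
proof (induction x rule: homogeneous_induct)
  case (homogeneous i x)
  obtain n where "n > 0" "x [^] (n::nat) \<in> V"
    using V_pow_torsion homogeneous by blast
  then show ?case
    using D_root[of x n] assms(1) component_subset[OF homogeneous] by simp
qed auto

text \<open>A subgroup: since \<open>H\<close> is cotorsion, a power of a kernel element of degree \<open>i\<close> has degree \<open>-i\<close>
  modulo \<open>H\<close>.\<close>

definition kernel_degrees :: "'c set" where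
  "kernel_degrees = {g \<in> carrier G. \<exists>i\<in>carrier G. \<exists>c\<in>B i. c \<noteq> \<zero> \<and> D c = \<zero> \<and> i \<otimes>\<^bsub>G\<^esub> g \<in> H}"

lemma H_subset_kernel_degrees: "H \<subseteq> kernel_degrees"
  using H_carrier by (fastforce simp: kernel_degrees_def intro!: bexI[of _ "\<one>\<^bsub>G\<^esub>"] bexI[of _ \<one>])

lemma subgroup_kernel_degrees: "subgroup kernel_degrees G"
proof (rule G.subgroupI)
  show "kernel_degrees \<subseteq> carrier G"
    by (auto simp: kernel_degrees_def)
  show "kernel_degrees \<noteq> {}"
    using H_subset_kernel_degrees H_one by blast
next
  fix g assume "g \<in> kernel_degrees"
  then obtain i c where g: "g \<in> carrier G" "i \<in> carrier G" "i \<otimes>\<^bsub>G\<^esub> g \<in> H"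
    and c: "c \<in> B i" "c \<noteq> \<zero>" "D c = \<zero>"
    by (auto simp: kernel_degrees_def)
  obtain n where n: "n > 0" "i [^]\<^bsub>G\<^esub> (n::nat) \<in> H"
    using torsion g(2) c by blast
  \<comment> \<open>With \<open>n = m + 1\<close> the kernel element \<open>c^m\<close> has degree
    \<open>m i\<close>, and \<open>m i - g = n i - (i + g)\<close> lies in \<open>H\<close>.\<close>
  then obtain m where m: "n = Suc m"
    using gr0_implies_Suc by blast
  have cR: "c \<in> carrier R"
    using c g component_subset by blast
  have "i \<otimes>\<^bsub>G\<^esub> (inv\<^bsub>G\<^esub> i \<otimes>\<^bsub>G\<^esub> inv\<^bsub>G\<^esub> g) = inv\<^bsub>G\<^esub> g"
    using g by (simp add: G.m_assoc[symmetric])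
  then have "i [^]\<^bsub>G\<^esub> m \<otimes>\<^bsub>G\<^esub> inv\<^bsub>G\<^esub> g = i [^]\<^bsub>G\<^esub> n \<otimes>\<^bsub>G\<^esub> inv\<^bsub>G\<^esub> (i \<otimes>\<^bsub>G\<^esub> g)"
    using g m by (simp add: G.inv_mult_group G.m_assoc G.m_comm[of "inv\<^bsub>G\<^esub> g"])
  then have "i [^]\<^bsub>G\<^esub> m \<otimes>\<^bsub>G\<^esub> inv\<^bsub>G\<^esub> g \<in> H"
    using n g H_mult H_inv by simp
  moreover have "c [^] m \<noteq> \<zero>"
    using c cR nat_pow_nonzero by simp
  moreover have "D (c [^] m) = \<zero>" "c [^] m \<in> B (i [^]\<^bsub>G\<^esub> m)"
    using c cR g component_pow by auto
  ultimately show "inv\<^bsub>G\<^esub> g \<in> kernel_degrees"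
    using g unfolding kernel_degrees_def by blast
next
  fix g h assume "g \<in> kernel_degrees" "h \<in> kernel_degrees"
  then obtain i c j b where g: "g \<in> carrier G" "i \<in> carrier G" "i \<otimes>\<^bsub>G\<^esub> g \<in> H"
    and c: "c \<in> B i" "c \<noteq> \<zero>" "D c = \<zero>"
    and h: "h \<in> carrier G" "j \<in> carrier G" "j \<otimes>\<^bsub>G\<^esub> h \<in> H"
    and b: "b \<in> B j" "b \<noteq> \<zero>" "D b = \<zero>"
    by (auto simp: kernel_degrees_def)
  have R: "c \<in> carrier R" "b \<in> carrier R"
    using b c g h component_subset by blast+
  have "(i \<otimes>\<^bsub>G\<^esub> j) \<otimes>\<^bsub>G\<^esub> (g \<otimes>\<^bsub>G\<^esub> h) = (i \<otimes>\<^bsub>G\<^esub> g) \<otimes>\<^bsub>G\<^esub> (j \<otimes>\<^bsub>G\<^esub> h)"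
    using g h by (simp add: G.m_ac)
  then have "(i \<otimes>\<^bsub>G\<^esub> j) \<otimes>\<^bsub>G\<^esub> (g \<otimes>\<^bsub>G\<^esub> h) \<in> H"
    using g h H_mult by simp
  moreover have "c \<otimes> b \<noteq> \<zero>" "D (c \<otimes> b) = \<zero>"
    using b c R integral by (auto simp: D_mult)
  moreover have "c \<otimes> b \<in> B (i \<otimes>\<^bsub>G\<^esub> j)"
    using b c g h component_mult by blast
  ultimately show "g \<otimes>\<^bsub>G\<^esub> h \<in> kernel_degrees"
    using g h unfolding kernel_degrees_def mem_Collect_eq by (metis G.m_closed)
qed

text \<open>The element \<open>c\<close> itself witnesses that \<open>-i\<close> is a kernel degree,
  since \<open>i - i = 0\<close> lies in \<open>H\<close>; the subgroup property gives
  \<open>i\<close>.\<close>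

lemma kernel_degree:
  assumes "i \<in> carrier G" "c \<in> B i" "c \<noteq> \<zero>" "D c = \<zero>"
  shows "i \<in> kernel_degrees"
proof -
  have "i \<otimes>\<^bsub>G\<^esub> inv\<^bsub>G\<^esub> i \<in> H"
    using assms(1) H_one by simp
  then have "inv\<^bsub>G\<^esub> i \<in> kernel_degrees"
    using assms unfolding kernel_degrees_def by (metis (mono_tags, lifting) G.inv_closed mem_Collect_eq)
  then show ?thesis
    using subgroup.m_inv_closed[OF subgroup_kernel_degrees] assms(1) by fastforce
qed

text \<open>Some homogeneous \<open>b\<close> has \<open>D b\<close> nonzero. If
  \<open>(D ^^ n) b\<close> is its last nonzero iterate, then \<open>n > 0\<close> and the preceding
  iterate is a local slice, homogeneous because \<open>D\<close> is.\<close>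

lemma homogeneous_slice:
  assumes "x \<in> carrier R" "D x \<noteq> \<zero>"
  obtains s w where "w \<in> carrier G" "s \<in> B w" "D s \<noteq> \<zero>" "D (D s) = \<zero>"
proof -
  have "\<exists>i b. i \<in> carrier G \<and> b \<in> B i \<and> D b \<noteq> \<zero>"
  proof (rule ccontr)
    assume none: "\<not> ?thesis"
    have "D x = \<zero>"
      using assms(1) by (induction x rule: homogeneous_induct) (use none in auto)
    then show False
      using assms(2) by simp
  qed
  then obtain i b where b: "i \<in> carrier G" "b \<in> B i" "D b \<noteq> \<zero>"
    by blast
  then have bR: "b \<in> carrier R" "b \<noteq> \<zero>"
    using component_subset by auto
  obtain n where n: "(D ^^ n) b \<noteq> \<zero>" "(D ^^ Suc n) b = \<zero>"
    using iter_top[OF bR] by blast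
  then have "n \<noteq> 0"
    using b(3) by (metis funpow_0 funpow_simps_right(2) comp_apply)
  then obtain m where m: "n = Suc m"
    using not0_implies_Suc by blast
  show thesis
    using that[of "i \<otimes>\<^bsub>G\<^esub> d [^]\<^bsub>G\<^esub> m" "(D ^^ m) b"] iter_degree b n d_carrier by (simp add: m)
qed

end

section \<open>The derivation of the Veronese subring obtained from a homogeneous local
  slice\<close>

locale sliced_homogeneous_lnd = homogeneous_lnd R G B K H D d
  for R (structure) and G and B and K and H and D and d +
  fixes s w
  assumes w_carrier: "w \<in> carrier G" and s_degree: "s \<in> B w"
    and Ds: "D s \<noteq> \<zero>" and DDs: "D (D s) = \<zero>"
begin

text \<open>The condition on \<open>n\<close> says that some nonzero homogeneous kernel element
  \<open>c\<close> makes the degree of \<open>c s^n\<close> lie in \<open>H\<close>. So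
  \<open>e\<close> is the least positive exponent for which a kernel multiple of the power of
  \<open>s\<close> falls into \<open>V\<close>.\<close>

definition e :: nat where
  "e = (LEAST n. n > 0 \<and> w [^]\<^bsub>G\<^esub> n \<in> kernel_degrees)"

lemma s_closed: "s \<in> carrier R"
  using w_carrier s_degree component_subset by blast

lemma s_nonzero: "s \<noteq> \<zero>"
  using Ds by auto

lemma e_spec: "e > 0" "w [^]\<^bsub>G\<^esub> e \<in> kernel_degrees"
proof -
  obtain n where "n > 0" "w [^]\<^bsub>G\<^esub> (n::nat) \<in> H"
    using torsion w_carrier s_degree s_nonzero by blast
  then have "\<exists>n>0. w [^]\<^bsub>G\<^esub> (n::nat) \<in> kernel_degrees"
    using H_subset_kernel_degrees by blast
  then show "e > 0" "w [^]\<^bsub>G\<^esub> e \<in> kernel_degrees"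
    unfolding e_def by (metis (mono_tags, lifting) LeastI_ex)+
qed

lemma e_dvd:
  assumes "w [^]\<^bsub>G\<^esub> (n::nat) \<in> kernel_degrees"
  shows "e dvd n"
proof -
  interpret \<Gamma>: subgroup kernel_degrees G
    by (rule subgroup_kernel_degrees)
  have pow: "(w [^]\<^bsub>G\<^esub> e) [^]\<^bsub>G\<^esub> (k::nat) \<in> kernel_degrees" for k
    using e_spec(2) by (induction k) auto
  have "w [^]\<^bsub>G\<^esub> n = (w [^]\<^bsub>G\<^esub> e) [^]\<^bsub>G\<^esub> (n div e) \<otimes>\<^bsub>G\<^esub> w [^]\<^bsub>G\<^esub> (n mod e)"
    using w_carrier by (simp add: G.nat_pow_pow G.nat_pow_mult)
  then have "w [^]\<^bsub>G\<^esub> (n mod e) = inv\<^bsub>G\<^esub> ((w [^]\<^bsub>G\<^esub> e) [^]\<^bsub>G\<^esub> (n div e)) \<otimes>\<^bsub>G\<^esub> w [^]\<^bsub>G\<^esub> n"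
    using w_carrier by (simp add: G.m_assoc[symmetric])
  also have "\<dots> \<in> kernel_degrees"
    using assms pow by (intro \<Gamma>.m_closed \<Gamma>.m_inv_closed)
  finally have "\<not> n mod e > 0"
    using not_less_Least[of "n mod e" "\<lambda>n. n > 0 \<and> w [^]\<^bsub>G\<^esub> n \<in> kernel_degrees"] e_spec(1)
    unfolding e_def[symmetric] by auto
  then show ?thesis by auto
qed

text \<open>Induction on the nilpotency order \<open>n\<close>: with \<open>c = D\<^sup>n b\<close>, the top term of \<open>n! (D s)\<^sup>n b\<close> as a
  polynomial in \<open>s\<close> is \<open>c s\<^sup>n\<close>, and \<open>e\<close> divides \<open>n\<close> because \<open>n w\<close> is a kernel degree.\<close>

lemma local_divisibility:
  assumes "(D ^^ n) b = \<zero>" "j \<in> kernel_degrees" "b \<in> B j"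
  shows "\<exists>i\<in>carrier G. \<exists>f\<in>B i. f \<noteq> \<zero> \<and> D f = \<zero> \<and> (\<exists>y\<in>carrier R. f \<otimes> D b = s [^] (e - 1) \<otimes> y)"
  using assms
proof (induction n arbitrary: b j)
  case 0
  then show ?case
    using s_closed by (intro bexI[of _ "\<one>\<^bsub>G\<^esub>"] bexI[of _ \<one>]) (auto intro!: bexI[of _ \<zero>])
next
  case (Suc n)
  interpret \<Gamma>: subgroup kernel_degrees G
    by (rule subgroup_kernel_degrees)
  have j: "j \<in> carrier G"
    using Suc.prems \<Gamma>.mem_carrier by blast
  have b: "b \<in> carrier R"
    using Suc.prems j component_subset by blast
  define c where "c = (D ^^ n) b"
  define a where "a = D s"
  have a: "a \<in> carrier R" "D a = \<zero>" "a \<noteq> \<zero>" "a \<in> B (w \<otimes>\<^bsub>G\<^esub> d)"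
    using s_closed Ds DDs D_degree s_degree w_carrier by (auto simp: a_def)
  have c: "c \<in> carrier R" "D c = \<zero>" "c \<in> B (j \<otimes>\<^bsub>G\<^esub> d [^]\<^bsub>G\<^esub> n)"
    using Suc.prems b j iter_degree by (auto simp: c_def)
  consider "c = \<zero>" | "n = 0" | "c \<noteq> \<zero>" "n > 0" by blast
  then show ?case
  proof cases
    case 1
    then show ?thesis
      using Suc by (auto simp: c_def)
  next
    case 2
    then show ?thesis
      using Suc.prems s_closed
      by (intro bexI[of _ "\<one>\<^bsub>G\<^esub>"] bexI[of _ \<one>]) (auto intro!: bexI[of _ \<zero>])
  next
    case 3
    \<comment> \<open>Degree count modulo kernel degrees: \<open>c\<close> gives
      \<open>j + n d\<close>, hence \<open>n d\<close>; \<open>D s\<close> gives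
      \<open>w + d\<close>, hence \<open>n w + n d\<close>. The difference is \<open>n w\<close>,
      which is what \<open>e_dvd\<close> needs.\<close>
    have "j \<otimes>\<^bsub>G\<^esub> d [^]\<^bsub>G\<^esub> n \<in> kernel_degrees"
      using kernel_degree[OF _ c(3) 3(1) c(2)] j d_carrier by simp
    then have "inv\<^bsub>G\<^esub> j \<otimes>\<^bsub>G\<^esub> (j \<otimes>\<^bsub>G\<^esub> d [^]\<^bsub>G\<^esub> n) \<in> kernel_degrees"
      using Suc.prems by (intro \<Gamma>.m_closed[OF \<Gamma>.m_inv_closed])
    then have dn: "d [^]\<^bsub>G\<^esub> n \<in> kernel_degrees"
      using j d_carrier by (simp add: G.m_assoc[symmetric])
    have "w \<otimes>\<^bsub>G\<^esub> d \<in> kernel_degrees"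
      using kernel_degree[OF _ a(4) a(3) a(2)] w_carrier d_carrier by simp
    then have wdn: "(w \<otimes>\<^bsub>G\<^esub> d) [^]\<^bsub>G\<^esub> n \<in> kernel_degrees"
      by (induction n) auto
    have wdn_eq: "(w \<otimes>\<^bsub>G\<^esub> d) [^]\<^bsub>G\<^esub> n = w [^]\<^bsub>G\<^esub> n \<otimes>\<^bsub>G\<^esub> d [^]\<^bsub>G\<^esub> n"
      using w_carrier d_carrier by (simp add: G.nat_pow_distrib)
    have "(w \<otimes>\<^bsub>G\<^esub> d) [^]\<^bsub>G\<^esub> n \<otimes>\<^bsub>G\<^esub> inv\<^bsub>G\<^esub> (d [^]\<^bsub>G\<^esub> n) \<in> kernel_degrees"
      using wdn dn by (intro \<Gamma>.m_closed \<Gamma>.m_inv_closed)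
    then have "w [^]\<^bsub>G\<^esub> n \<in> kernel_degrees"
      using wdn_eq w_carrier d_carrier by (simp add: G.m_assoc)
    then have "e \<le> n"
      using e_dvd 3(2) dvd_imp_le by blast
    define N where "N = [(fact n :: nat)] \<cdot> \<one>"
    define g where "g = N \<otimes> a [^] n"
    have N: "N \<in> carrier R" "D N = \<zero>" "N \<noteq> \<zero>"
      using char_zero[of "fact n"] by (auto simp: N_def)
    have "N \<in> B \<one>\<^bsub>G\<^esub>"
      unfolding N_def by (rule component_nat)
    have "a [^] n \<in> B ((w \<otimes>\<^bsub>G\<^esub> d) [^]\<^bsub>G\<^esub> n)"
      using a w_carrier d_carrier by (intro component_pow) auto
    then have "g \<in> B (\<one>\<^bsub>G\<^esub> \<otimes>\<^bsub>G\<^esub> (w \<otimes>\<^bsub>G\<^esub> d) [^]\<^bsub>G\<^esub> n)"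
      using \<open>N \<in> B \<one>\<^bsub>G\<^esub>\<close> w_carrier d_carrier unfolding g_def by (intro component_mult) auto
    then have g: "g \<in> carrier R" "D g = \<zero>" "g \<noteq> \<zero>" "g \<in> B ((w \<otimes>\<^bsub>G\<^esub> d) [^]\<^bsub>G\<^esub> n)"
      using N a nat_pow_nonzero[of a n] integral w_carrier d_carrier by (auto simp: g_def D_mult)
    \<comment> \<open>Since \<open>(D ^^ n) (s^n) = g\<close>, both terms have the same
      \<open>n\<close>-th iterate \<open>g c\<close>, so \<open>b'\<close> has smaller order than
      \<open>b\<close>. Both terms have the same degree, which remains a kernel degree, and the
      induction hypothesis applies.\<close>
    define b' where "b' = g \<otimes> b \<ominus> c \<otimes> s [^] n"
    let ?j = "j \<otimes>\<^bsub>G\<^esub> (w \<otimes>\<^bsub>G\<^esub> d) [^]\<^bsub>G\<^esub> n"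
    have "?j \<in> kernel_degrees"
      using Suc.prems wdn by blast
    moreover have "b' \<in> B ?j"
    proof -
      have "g \<otimes> b \<in> B ?j"
        using component_mult[OF _ j g(4) Suc.prems(3)] w_carrier d_carrier j
        by (simp add: G.m_comm)
      moreover have "c \<otimes> s [^] n \<in> B (j \<otimes>\<^bsub>G\<^esub> d [^]\<^bsub>G\<^esub> n \<otimes>\<^bsub>G\<^esub> w [^]\<^bsub>G\<^esub> n)"
        using c component_pow[OF w_carrier s_degree] j w_carrier d_carrier
        by (intro component_mult) auto
      then have "c \<otimes> s [^] n \<in> B ?j"
        using j w_carrier d_carrier wdn_eq by (simp add: G.m_ac)
      ultimately show ?thesis
        unfolding b'_def using j w_carrier d_carrier by (intro component_diff) auto
    qed
    moreover have "(D ^^ n) b' = \<zero>"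
    proof -
      have "(D ^^ n) b' = g \<otimes> c \<ominus> c \<otimes> (N \<otimes> a [^] n)"
        unfolding b'_def a_minus_def using g b c s_closed DDs iter_slice_pow[OF s_closed DDs, of n]
        by (simp add: iter_add iter_minus iter_kernel_mult c_def N_def a_def)
      then show ?thesis
        using g c by (simp add: g_def[symmetric] m_comm a_minus_def r_neg)
    qed
    ultimately obtain i f y where f: "i \<in> carrier G" "f \<in> B i" "f \<noteq> \<zero>" "D f = \<zero>"
      and y: "y \<in> carrier R" "f \<otimes> D b' = s [^] (e - 1) \<otimes> y"
      using Suc.IH[of b' ?j] by blast
    have fR: "f \<in> carrier R"
      using f component_subset by blast
    obtain m where m: "n = Suc m"
      using 3(2) gr0_implies_Suc by blast
    \<comment> \<open>The cofactor in \<open>D (s^n) = n s^(n-1) D s = s^(e-1) u\<close>, which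
      exists because \<open>e \<le> n\<close>.\<close>
    define u where "u = [n] \<cdot> \<one> \<otimes> s [^] (n - e) \<otimes> a"
    have u: "u \<in> carrier R"
      using s_closed a by (simp add: u_def)
    have "D (s [^] n) = [n] \<cdot> \<one> \<otimes> (s [^] m \<otimes> a)"
      using D_pow[OF s_closed, of m] by (simp only: m a_def)
    also have "s [^] m = s [^] (e - 1) \<otimes> s [^] (n - e)"
      using s_closed \<open>e \<le> n\<close> e_spec(1) m by (simp add: nat_pow_mult)
    finally have "D (s [^] n) = s [^] (e - 1) \<otimes> u"
      using s_closed a by (simp add: u_def m_ac)
    then have "D b' = g \<otimes> D b \<ominus> c \<otimes> (s [^] (e - 1) \<otimes> u)"
      unfolding b'_def a_minus_def using g b c s_closed by (simp add: D_kernel_mult)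
    then have "g \<otimes> D b = D b' \<oplus> c \<otimes> (s [^] (e - 1) \<otimes> u)"
      using g b c u s_closed by (simp add: a_minus_def a_assoc l_neg)
    \<comment> \<open>The multiplier \<open>f\<close> for \<open>b'\<close> and the factor
      \<open>g\<close> used in forming \<open>b'\<close> combine: \<open>f g\<close> is the
      multiplier for \<open>b\<close>.\<close>
    then have "(f \<otimes> g) \<otimes> D b = f \<otimes> D b' \<oplus> f \<otimes> (c \<otimes> (s [^] (e - 1) \<otimes> u))"
      using fR g b c u s_closed by (simp add: m_assoc r_distr b'_def)
    also have "\<dots> = s [^] (e - 1) \<otimes> (y \<oplus> f \<otimes> (c \<otimes> u))"
      using fR c u y s_closed by (simp add: l_distr r_distr m_ac)
    finally have eq: "(f \<otimes> g) \<otimes> D b = s [^] (e - 1) \<otimes> (y \<oplus> f \<otimes> (c \<otimes> u))" .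
    have "f \<otimes> g \<noteq> \<zero>" "D (f \<otimes> g) = \<zero>"
      using f g fR integral by (auto simp: D_mult)
    moreover have "f \<otimes> g \<in> B (i \<otimes>\<^bsub>G\<^esub> (w \<otimes>\<^bsub>G\<^esub> d) [^]\<^bsub>G\<^esub> n)"
      using f g w_carrier d_carrier by (intro component_mult) auto
    moreover have "i \<otimes>\<^bsub>G\<^esub> (w \<otimes>\<^bsub>G\<^esub> d) [^]\<^bsub>G\<^esub> n \<in> carrier G" "y \<oplus> f \<otimes> (c \<otimes> u) \<in> carrier R"
      using f y fR c u w_carrier d_carrier by auto
    ultimately show ?thesis
      using eq by blast
  qed
qed

text \<open>These are the elements that \<open>f s^(1-e) D\<close>, a derivation into the field of
  fractions, sends into the ring. The product rule for that derivation is the reason why they are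
  closed under multiplication.\<close>

definition divisible :: "'a \<Rightarrow> 'a set" where
  "divisible f = {b \<in> carrier R. \<exists>y\<in>carrier R. f \<otimes> D b = s [^] (e - 1) \<otimes> y}"

lemma divisible_add:
  assumes "f \<in> carrier R" "x \<in> divisible f" "y \<in> divisible f"
  shows "x \<oplus> y \<in> divisible f"
proof -
  obtain u v where "x \<in> carrier R" "u \<in> carrier R" "f \<otimes> D x = s [^] (e - 1) \<otimes> u"
    and "y \<in> carrier R" "v \<in> carrier R" "f \<otimes> D y = s [^] (e - 1) \<otimes> v"
    using assms by (auto simp: divisible_def)
  then have "f \<otimes> D (x \<oplus> y) = s [^] (e - 1) \<otimes> (u \<oplus> v)"
    using assms(1) s_closed by (simp add: r_distr)
  then show ?thesis
    using \<open>x \<in> carrier R\<close> \<open>y \<in> carrier R\<close> \<open>u \<in> carrier R\<close> \<open>v \<in> carrier R\<close>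
    by (auto simp: divisible_def)
qed

lemma divisible_mult:
  assumes "f \<in> carrier R" "x \<in> divisible f" "y \<in> divisible f"
  shows "x \<otimes> y \<in> divisible f"
proof -
  obtain u v where x: "x \<in> carrier R" "u \<in> carrier R" "f \<otimes> D x = s [^] (e - 1) \<otimes> u"
    and y: "y \<in> carrier R" "v \<in> carrier R" "f \<otimes> D y = s [^] (e - 1) \<otimes> v"
    using assms by (auto simp: divisible_def)
  have "f \<otimes> D (x \<otimes> y) = (f \<otimes> D x) \<otimes> y \<oplus> x \<otimes> (f \<otimes> D y)"
    using assms(1) x(1,2) y(1,2) by (simp add: D_mult r_distr m_ac)
  also have "\<dots> = s [^] (e - 1) \<otimes> (u \<otimes> y \<oplus> x \<otimes> v)"
    using x y s_closed by (simp add: l_distr r_distr m_ac)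
  finally show ?thesis
    using x y unfolding divisible_def by blast
qed

lemma divisible_kernel: "\<lbrakk>f \<in> carrier R; x \<in> carrier R; D x = \<zero>\<rbrakk> \<Longrightarrow> x \<in> divisible f"
  using s_closed by (auto simp: divisible_def intro!: bexI[of _ \<zero>])

lemma divisible_minus:
  assumes "f \<in> carrier R" "x \<in> divisible f"
  shows "\<ominus> x \<in> divisible f"
  using divisible_mult[OF assms(1) divisible_kernel[OF assms(1), of "\<ominus> \<one>"] assms(2)] assms(2)
  by (simp add: divisible_def l_minus)

lemma divisible_multiple:
  assumes "f \<in> carrier R" "g \<in> carrier R" "x \<in> divisible f"
  shows "x \<in> divisible (g \<otimes> f)"
proof -
  obtain u where u: "x \<in> carrier R" "u \<in> carrier R" "f \<otimes> D x = s [^] (e - 1) \<otimes> u"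
    using assms by (auto simp: divisible_def)
  then have "(g \<otimes> f) \<otimes> D x = g \<otimes> (s [^] (e - 1) \<otimes> u)"
    using assms by (simp add: m_assoc)
  also have "\<dots> = s [^] (e - 1) \<otimes> (g \<otimes> u)"
    using assms s_closed u by (simp add: m_lcomm)
  finally show ?thesis
    using assms u unfolding divisible_def by blast
qed

text \<open>\<open>local_divisibility\<close> applies to each generator of \<open>V\<close> because
  degrees in \<open>H\<close> are kernel degrees. The product of the finitely many multipliers
  serves all generators, and the closure properties of \<open>divisible\<close> carry it over to
  \<open>V\<close>; the ground field lies in the kernel.\<close>

lemma uniform_divisibility:
  assumes "finite S0" "S0 \<subseteq> carrier R" "generate_ring R (K \<union> S0) = carrier R"
  shows "\<exists>i\<in>carrier G. \<exists>f\<in>B i. f \<noteq> \<zero> \<and> D f = \<zero> \<and> V \<subseteq> divisible f"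
proof -
  obtain F where F: "finite F" "\<And>x. x \<in> F \<Longrightarrow> \<exists>i\<in>H. x \<in> B i" "V \<subseteq> generate_ring R (K \<union> F)"
    using veronese_finitely_generated[OF assms] by metis
  have "\<exists>i\<in>carrier G. \<exists>f\<in>B i. f \<noteq> \<zero> \<and> D f = \<zero> \<and> F \<subseteq> divisible f"
    using F(1,2)
  proof (induction F)
    case empty
    then show ?case
      by (intro bexI[of _ "\<one>\<^bsub>G\<^esub>"] bexI[of _ \<one>]) auto
  next
    case (insert x F)
    then obtain i f where f: "i \<in> carrier G" "f \<in> B i" "f \<noteq> \<zero>" "D f = \<zero>" "F \<subseteq> divisible f"
      by auto
    obtain j where j: "j \<in> H" "x \<in> B j"
      using insert.prems by blast
    have x: "x \<in> carrier R"
      using j H_carrier component_subset by blast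
    obtain n where "(D ^^ n) x = \<zero>"
      using locally_nilpotent x by blast
    then obtain k g where g: "k \<in> carrier G" "g \<in> B k" "g \<noteq> \<zero>" "D g = \<zero>" "x \<in> divisible g"
      using local_divisibility[of n x j] j H_subset_kernel_degrees x unfolding divisible_def by blast
    have fg: "f \<in> carrier R" "g \<in> carrier R"
      using f g component_subset by blast+
    have "g \<otimes> f \<noteq> \<zero>" "D (g \<otimes> f) = \<zero>"
      using f g fg integral by (auto simp: D_mult)
    moreover have "insert x F \<subseteq> divisible (g \<otimes> f)"
      using divisible_multiple[of f g] divisible_multiple[of g f x] f g fg m_comm[of f g] by auto
    moreover have "g \<otimes> f \<in> B (k \<otimes>\<^bsub>G\<^esub> i)" "k \<otimes>\<^bsub>G\<^esub> i \<in> carrier G"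
      using f g component_mult by auto
    ultimately show ?case
      by blast
  qed
  then obtain i f where f: "i \<in> carrier G" "f \<in> B i" "f \<noteq> \<zero>" "D f = \<zero>" "F \<subseteq> divisible f"
    by blast
  have fR: "f \<in> carrier R"
    using f component_subset by blast
  have "x \<in> divisible f" if "x \<in> generate_ring R (K \<union> F)" for x
    using that
  proof induction
    case (incl h)
    then show ?case
      using f(5) divisible_kernel[OF fR] D_subfield[OF ground_subfield] subringE(1)[OF subfieldE(1)[OF ground_subfield]]
      by blast
  qed (use fR divisible_add divisible_mult divisible_minus divisible_kernel in auto)
  then show ?thesis
    using f F(3) by blast
qed

text \<open>The quotient by \<open>s^(e-1)\<close> must shift degrees by an element of
  \<open>H\<close>. Choose \<open>c\<close> in the kernel with \<open>\<gamma> + e w\<close> in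
  \<open>H\<close>; then \<open>d - (e-1) w\<close> is congruent modulo \<open>H\<close> to
  \<open>\<beta> = w + d + \<gamma>\<close>, the degree of the kernel element
  \<open>b = D s \<otimes> c\<close>. So the multiplier needs degree \<open>-\<beta>\<close> modulo
  \<open>H\<close>. As \<open>k \<phi>\<close> and \<open>(m+1) \<beta>\<close> lie in
  \<open>H\<close>, the element \<open>f^k b^m\<close> has it.\<close>

lemma homogeneous_multiplier:
  assumes "finite S0" "S0 \<subseteq> carrier R" "generate_ring R (K \<union> S0) = carrier R"
  obtains \<eta> h \<epsilon> where "\<eta> \<in> carrier G" "h \<in> B \<eta>" "h \<noteq> \<zero>" "D h = \<zero>" "V \<subseteq> divisible h"
    and "\<epsilon> \<in> H" "\<epsilon> \<otimes>\<^bsub>G\<^esub> w [^]\<^bsub>G\<^esub> (e - 1) = \<eta> \<otimes>\<^bsub>G\<^esub> d"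
proof -
  obtain \<phi> f where f: "\<phi> \<in> carrier G" "f \<in> B \<phi>" "f \<noteq> \<zero>" "D f = \<zero>" "V \<subseteq> divisible f"
    using uniform_divisibility[OF assms] by blast
  obtain \<gamma> c where c: "\<gamma> \<in> carrier G" "c \<in> B \<gamma>" "c \<noteq> \<zero>" "D c = \<zero>" "\<gamma> \<otimes>\<^bsub>G\<^esub> w [^]\<^bsub>G\<^esub> e \<in> H"
    using e_spec(2) by (auto simp: kernel_degrees_def)
  define b where "b = D s \<otimes> c"
  define \<beta> where "\<beta> = (w \<otimes>\<^bsub>G\<^esub> d) \<otimes>\<^bsub>G\<^esub> \<gamma>"
  have R: "f \<in> carrier R" "c \<in> carrier R"
    using f c component_subset by blast+
  have \<beta>: "\<beta> \<in> carrier G"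
    using c w_carrier d_carrier by (simp add: \<beta>_def)
  have b: "b \<in> carrier R" "b \<in> B \<beta>" "b \<noteq> \<zero>" "D b = \<zero>"
    using c R Ds DDs s_closed integral component_mult[of "w \<otimes>\<^bsub>G\<^esub> d" \<gamma> "D s" c] w_carrier
      d_carrier D_degree s_degree
    by (auto simp: b_def \<beta>_def D_mult)
  obtain k where k: "k > 0" "\<phi> [^]\<^bsub>G\<^esub> (k::nat) \<in> H"
    using torsion f by blast
  obtain n where n: "n > 0" "\<beta> [^]\<^bsub>G\<^esub> (n::nat) \<in> H"
    using torsion b \<beta> by blast
  obtain l m where l: "k = Suc l" and m: "n = Suc m"
    using k n gr0_implies_Suc by metis
  \<comment> \<open>One factor \<open>f\<close> is split off so that \<open>h\<close> is visibly a
    multiple of \<open>f\<close> and inherits the divisibility.\<close>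
  define h where "h = (f [^] l \<otimes> b [^] m) \<otimes> f"
  define \<eta> where "\<eta> = \<phi> [^]\<^bsub>G\<^esub> k \<otimes>\<^bsub>G\<^esub> \<beta> [^]\<^bsub>G\<^esub> m"
  define \<epsilon> where "\<epsilon> = \<eta> \<otimes>\<^bsub>G\<^esub> d \<otimes>\<^bsub>G\<^esub> inv\<^bsub>G\<^esub> (w [^]\<^bsub>G\<^esub> (e - 1))"
  have \<eta>: "\<eta> \<in> carrier G"
    using f \<beta> by (simp add: \<eta>_def)
  have "h = f [^] k \<otimes> b [^] m"
    using R b by (simp add: h_def l m_ac)
  then have "h \<in> B \<eta>"
    using f \<beta> b by (auto simp: \<eta>_def intro!: component_mult component_pow)
  moreover have "h \<noteq> \<zero>" "D h = \<zero>"
    using f b R nat_pow_nonzero[of f l] nat_pow_nonzero[of b m]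
    by (auto simp: h_def D_mult integral_iff)
  moreover have "V \<subseteq> divisible h"
    using f(5) divisible_multiple[of f "f [^] l \<otimes> b [^] m"] R b by (auto simp: h_def)
  moreover have "\<epsilon> \<in> H"
  proof -
    have we: "w [^]\<^bsub>G\<^esub> e = w [^]\<^bsub>G\<^esub> (e - 1) \<otimes>\<^bsub>G\<^esub> w"
      using e_spec(1) by (metis G.nat_pow_Suc Suc_pred' )
    have "(\<gamma> \<otimes>\<^bsub>G\<^esub> w [^]\<^bsub>G\<^esub> e) \<otimes>\<^bsub>G\<^esub> \<epsilon> =
        (\<gamma> \<otimes>\<^bsub>G\<^esub> w \<otimes>\<^bsub>G\<^esub> \<eta> \<otimes>\<^bsub>G\<^esub> d) \<otimes>\<^bsub>G\<^esub> (w [^]\<^bsub>G\<^esub> (e - 1) \<otimes>\<^bsub>G\<^esub> inv\<^bsub>G\<^esub> (w [^]\<^bsub>G\<^esub> (e - 1)))"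
      unfolding we \<epsilon>_def using \<eta> c w_carrier d_carrier by (simp only: G.m_ac G.m_closed G.inv_closed G.nat_pow_closed)
    also have "\<dots> = \<eta> \<otimes>\<^bsub>G\<^esub> \<beta>"
      using \<eta> c w_carrier d_carrier by (simp add: \<beta>_def G.m_ac)
    also have "\<dots> = \<phi> [^]\<^bsub>G\<^esub> k \<otimes>\<^bsub>G\<^esub> \<beta> [^]\<^bsub>G\<^esub> n"
      using f \<beta> by (simp add: \<eta>_def m G.m_assoc)
    also have "\<dots> \<in> H"
      using k n H_mult by blast
    finally show ?thesis
      using H_cancel[OF c(5), of \<epsilon>] \<eta> w_carrier d_carrier \<epsilon>_def by simp
  qed
  moreover have "\<epsilon> \<otimes>\<^bsub>G\<^esub> w [^]\<^bsub>G\<^esub> (e - 1) = \<eta> \<otimes>\<^bsub>G\<^esub> d"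
    using \<eta> w_carrier d_carrier by (simp add: \<epsilon>_def G.m_assoc)
  ultimately show thesis
    using that \<eta> by blast
qed

text \<open>\<open>E\<close> is \<open>h s^(1-e) D\<close> restricted to \<open>V\<close>. The
  quotient is picked by choice and is unique since \<open>s^(e-1)\<close> cancels, so identities for
  \<open>E\<close> are checked after multiplication by this power. The zeros of \<open>E\<close> are
  those of \<open>D\<close> because \<open>h\<close> and the power of \<open>s\<close> are
  nonzero.\<close>

lemma veronese_lnd:
  assumes "finite S0" "S0 \<subseteq> carrier R" "generate_ring R (K \<union> S0) = carrier R"
  obtains E where "E \<in> HLND (G\<lparr>carrier := H\<rparr>) (veronese_ring R B H) B"
    and "\<And>x. x \<in> V \<Longrightarrow> E x = \<zero> \<longleftrightarrow> D x = \<zero>"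
proof -
  obtain \<eta> h \<epsilon> where h: "\<eta> \<in> carrier G" "h \<in> B \<eta>" "h \<noteq> \<zero>" "D h = \<zero>" "V \<subseteq> divisible h"
    and \<epsilon>: "\<epsilon> \<in> H" "\<epsilon> \<otimes>\<^bsub>G\<^esub> w [^]\<^bsub>G\<^esub> (e - 1) = \<eta> \<otimes>\<^bsub>G\<^esub> d"
    using homogeneous_multiplier[OF assms] by metis
  have hR: "h \<in> carrier R"
    using h component_subset by blast
  have \<epsilon>G: "\<epsilon> \<in> carrier G"
    using \<epsilon> H_carrier by blast
  let ?p = "s [^] (e - 1)"
  have p: "?p \<in> carrier R" "?p \<noteq> \<zero>" "?p \<in> B (w [^]\<^bsub>G\<^esub> (e - 1))"
    using s_closed s_nonzero nat_pow_nonzero component_pow w_carrier s_degree by auto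
  define E where "E = (\<lambda>b\<in>V. SOME y. y \<in> carrier R \<and> ?p \<otimes> y = h \<otimes> D b)"
  have E: "E b \<in> carrier R" "?p \<otimes> E b = h \<otimes> D b" if "b \<in> V" for b
  proof -
    have "\<exists>y. y \<in> carrier R \<and> ?p \<otimes> y = h \<otimes> D b"
      using h(5) that by (force simp: divisible_def)
    then have "E b \<in> carrier R \<and> ?p \<otimes> E b = h \<otimes> D b"
      using that someI_ex[of "\<lambda>y. y \<in> carrier R \<and> ?p \<otimes> y = h \<otimes> D b"] by (simp add: E_def)
    then show "E b \<in> carrier R" "?p \<otimes> E b = h \<otimes> D b" by auto
  qed
  have E_eqI: "E b = y" if "b \<in> V" "y \<in> carrier R" "?p \<otimes> y = h \<otimes> D b" for b y
    using E[OF that(1)] that p m_lcancel by metis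
  have E_zero_iff: "E x = \<zero> \<longleftrightarrow> D x = \<zero>" if "x \<in> V" for x
    using E[OF that] p h hR V_closed[OF that] integral[of h "D x"] integral[of ?p "E x"] by auto
  \<comment> \<open>The product of \<open>s^(e-1)\<close> with \<open>E x\<close> has degree
    \<open>\<eta> + i + d\<close>, which is \<open>(i + \<epsilon>) + (e-1) w\<close> by the choice
    of \<open>\<epsilon>\<close>; the power of \<open>s\<close> is then divided out.\<close>
  have E_degree: "E x \<in> B (i \<otimes>\<^bsub>G\<^esub> \<epsilon>)" if "i \<in> H" "x \<in> B i" for i x
  proof -
    have i: "i \<in> carrier G" and x: "x \<in> V"
      using that H_carrier V_homogeneous by auto
    have "?p \<otimes> E x \<in> B (\<eta> \<otimes>\<^bsub>G\<^esub> (i \<otimes>\<^bsub>G\<^esub> d))"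
      using component_mult[OF h(1) _ h(2) D_degree[OF i that(2)]] i d_carrier E(2)[OF x] by simp
    also have "\<eta> \<otimes>\<^bsub>G\<^esub> (i \<otimes>\<^bsub>G\<^esub> d) = (i \<otimes>\<^bsub>G\<^esub> \<epsilon>) \<otimes>\<^bsub>G\<^esub> w [^]\<^bsub>G\<^esub> (e - 1)"
      using \<epsilon>(2) i h d_carrier \<epsilon>G w_carrier by (simp add: G.m_assoc G.m_lcomm)
    finally show ?thesis
      using component_quotient[OF _ _ p(3) p(2)] i \<epsilon>G E[OF x] w_carrier by simp
  qed
  have E_add: "E (x \<oplus> y) = E x \<oplus> E y" if "x \<in> V" "y \<in> V" for x y
    using E[OF that(1)] E[OF that(2)] that p(1) hR V_closed
    by (intro E_eqI V_add) (auto simp: r_distr)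
  have E_closed: "E x \<in> V" if "x \<in> V" for x
    using that
  proof (induction x rule: V_induct)
    case zero
    then show ?case
      using E_zero_iff[OF V_zero] V_zero by simp
  next
    case (homogeneous i x)
    then show ?case
      using V_homogeneous[OF H_mult E_degree] \<epsilon>(1) by blast
  qed (auto simp: E_add V_add)
  have E_mult: "E (x \<otimes> y) = E x \<otimes> y \<oplus> x \<otimes> E y" if "x \<in> V" "y \<in> V" for x y
  proof (rule E_eqI)
    have R: "x \<in> carrier R" "y \<in> carrier R"
      using that V_closed by auto
    have "?p \<otimes> (E x \<otimes> y \<oplus> x \<otimes> E y) = (?p \<otimes> E x) \<otimes> y \<oplus> x \<otimes> (?p \<otimes> E y)"
      using E(1)[OF that(1)] E(1)[OF that(2)] R p(1) by (simp only: r_distr m_ac m_closed a_closed)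
    also have "\<dots> = h \<otimes> D (x \<otimes> y)"
      using E(2)[OF that(1)] E(2)[OF that(2)] R hR by (simp add: D_mult r_distr m_ac)
    finally show "?p \<otimes> (E x \<otimes> y \<oplus> x \<otimes> E y) = h \<otimes> D (x \<otimes> y)" .
  qed (use that E(1) V_closed V_mult in auto)
  \<comment> \<open>Applying \<open>E\<close> lowers the order with respect to \<open>D\<close>: if
    \<open>n + 1\<close> iterates of \<open>D\<close> kill \<open>x\<close>, then \<open>n\<close>
    of them kill \<open>h D x\<close>, a multiple of \<open>E x\<close> by a nonzero factor, and so
    also \<open>E x\<close>.\<close>
  have E_nilpotent: "(E ^^ n) x = \<zero>" if "x \<in> V" "(D ^^ n) x = \<zero>" for n x
    using that
  proof (induction n arbitrary: x)
    case (Suc n)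
    have x: "x \<in> carrier R"
      using Suc.prems V_closed by blast
    have "(D ^^ n) (?p \<otimes> E x) = h \<otimes> (D ^^ n) (D x)"
      using E(2) Suc.prems iter_kernel_mult[OF hR h(4)] x by simp
    also have "\<dots> = \<zero>"
      using Suc.prems hR x by (simp add: funpow_swap1)
    finally have "(D ^^ n) (E x) = \<zero>"
      using iter_mult_zeroD[OF p(1) _ p(2)] E Suc.prems by blast
    then show ?case
      using Suc.IH[of "E x"] E_closed Suc.prems by (simp add: funpow_swap1)
  qed simp
  let ?R = "veronese_ring R B H"
  have carrier: "carrier ?R = V"
    by (simp add: veronese_ring_def)
  have "E \<in> derivations ?R"
    unfolding derivations_def carrier using E_closed E_add E_mult
    by (auto simp: veronese_ring_def E_def[symmetric]) (auto simp: E_def)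
  moreover have "\<exists>n>0. (E ^^ n) x = \<zero>" if x: "x \<in> V" for x
  proof -
    obtain n where "(D ^^ n) x = \<zero>"
      using locally_nilpotent V_closed x by blast
    then have "(E ^^ Suc n) x = \<zero>"
      using x by (intro E_nilpotent iter_zero_mono[of n x "Suc n"]) auto
    then show ?thesis by blast
  qed
  moreover have "homogeneous (G\<lparr>carrier := H\<rparr>) B E"
    unfolding homogeneous_def using \<epsilon>(1) E_degree by auto
  ultimately have "E \<in> HLND (G\<lparr>carrier := H\<rparr>) ?R B"
    unfolding HLND_def LND_def carrier by (auto simp: veronese_ring_def)
  then show thesis
    using that E_zero_iff by blast
qed

end

section \<open>Kernels of homogeneous derivations and their traces on the Veronese subring\<close>

context homogeneous_lnd
begin

text \<open>The kernel of a homogeneous derivation is a graded subring: the components of a kernel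
  element are kernel elements. Hence taking the part with degrees in \<open>H\<close> is the same as
  intersecting with \<open>V\<close>.\<close>

lemma veronese_kernel: "veronese R B H {x \<in> carrier R. D x = \<zero>} = {x \<in> V. D x = \<zero>}"
proof (rule equalityI; rule subsetI)
  fix x assume "x \<in> veronese R B H {x \<in> carrier R. D x = \<zero>}"
  then have x: "x \<in> carrier R" "\<And>i. i \<in> carrier G \<Longrightarrow> D (proj i x) = \<zero> \<and> (i \<notin> H \<longrightarrow> proj i x = \<zero>)"
    using veronese_iff[of "{x \<in> carrier R. D x = \<zero>}" x] by auto
  have "(\<Oplus>i\<in>supp x. proj i x) \<in> {x \<in> carrier R. D x = \<zero>}"
    using x supp_subset[of x] by (intro finsum_closed_under) auto
  then have "x \<in> {x \<in> carrier R. D x = \<zero>}"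
    by (rule ssubst[OF proj_spec(3)[OF x(1)]])
  then show "x \<in> {x \<in> V. D x = \<zero>}"
    using x V_iff by simp
next
  fix x assume "x \<in> {x \<in> V. D x = \<zero>}"
  then show "x \<in> veronese R B H {x \<in> carrier R. D x = \<zero>}"
    using veronese_iff[of "{x \<in> carrier R. D x = \<zero>}" x] V_iff D_proj_kernel by simp
qed

text \<open>The derivation \<open>E\<close> of \<open>V\<close> may differ from \<open>D\<close>,
  but it has the same zeros on \<open>V\<close>, which determines its kernel. It is nonzero because
  \<open>D\<close> does not vanish on all of \<open>V\<close>.\<close>

lemma veronese_kernel_in_KHLND:
  assumes "finite S0" "S0 \<subseteq> carrier R" "generate_ring R (K \<union> S0) = carrier R"
    and nonzero: "x \<in> carrier R" "D x \<noteq> \<zero>"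
  shows "veronese R B H {x \<in> carrier R. D x = \<zero>} \<in> KHLND (G\<lparr>carrier := H\<rparr>) (veronese_ring R B H) B"
proof -
  obtain s w where "w \<in> carrier G" "s \<in> B w" "D s \<noteq> \<zero>" "D (D s) = \<zero>"
    using homogeneous_slice[OF nonzero] by blast
  then interpret sliced_homogeneous_lnd R G B K H D d s w
    by unfold_locales
  obtain E where E: "E \<in> HLND (G\<lparr>carrier := H\<rparr>) (veronese_ring R B H) B"
    "\<And>x. x \<in> V \<Longrightarrow> E x = \<zero> \<longleftrightarrow> D x = \<zero>"
    using veronese_lnd[OF assms(1-3)] by metis
  obtain y where "y \<in> V" "D y \<noteq> \<zero>"
    using D_vanishes_on_veronese nonzero by blast
  then have "E \<noteq> zero_derivation (veronese_ring R B H)"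
    using E(2) by (auto simp: zero_derivation_def veronese_ring_def)
  moreover have "a_kernel (veronese_ring R B H) (veronese_ring R B H) E = {x \<in> V. D x = \<zero>}"
    using E(2) by (auto simp: a_kernel_def' veronese_ring_def)
  ultimately show ?thesis
    unfolding KHLND_def veronese_kernel using E(1) by blast
qed

text \<open>One half of injectivity. A component of an element killed by \<open>D\<close> has a
  power in \<open>V\<close>; that power is killed by \<open>D\<close>, so by \<open>D'\<close>, and
  the root property removes the exponent.\<close>

lemma homogeneous_kernel_subset:
  assumes "derivation R D'" "{x \<in> V. D x = \<zero>} \<subseteq> {x \<in> V. D' x = \<zero>}"
    and D'_root: "\<And>x n. \<lbrakk>x \<in> carrier R; n > 0; D' (x [^] (n::nat)) = \<zero>\<rbrakk> \<Longrightarrow> D' x = \<zero>"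
  shows "{x \<in> carrier R. D x = \<zero>} \<subseteq> {x \<in> carrier R. D' x = \<zero>}"
proof
  interpret D': derivation R D'
    by fact
  fix x assume "x \<in> {x \<in> carrier R. D x = \<zero>}"
  then have x: "x \<in> carrier R" "D x = \<zero>" by auto
  have proj_kernel: "D' (proj i x) = \<zero>" if i: "i \<in> carrier G" for i
  proof -
    obtain n where n: "n > 0" "proj i x [^] (n::nat) \<in> V"
      using V_pow_torsion[OF i proj_in[OF i x(1)]] by blast
    have "D (proj i x [^] n) = \<zero>"
      using D_proj_kernel[OF x i] i x by simp
    then show ?thesis
      using D'_root[of "proj i x" n] n assms(2) i x by blast
  qed
  have "(\<Oplus>i\<in>supp x. proj i x) \<in> {x \<in> carrier R. D' x = \<zero>}"
    using x proj_kernel supp_subset[of x] by (intro finsum_closed_under) auto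
  then show "x \<in> {x \<in> carrier R. D' x = \<zero>}"
    by (rule ssubst[OF proj_spec(3)[OF x(1)]])
qed

end

subsection \<open>Leading components for an ordered grading group\<close>

text \<open>Levi's theorem that torsion-free abelian groups are orderable. The positive cone is a
  maximal subsemigroup without the identity, given by Zorn's lemma.\<close>

lemma (in comm_group) torsion_free_positive_cone:
  assumes "torsion_free_group G"
  obtains P where "P \<subseteq> carrier G" "\<one> \<notin> P" "\<And>x y. \<lbrakk>x \<in> P; y \<in> P\<rbrakk> \<Longrightarrow> x \<otimes> y \<in> P"
    and "\<And>x. \<lbrakk>x \<in> carrier G; x \<noteq> \<one>\<rbrakk> \<Longrightarrow> x \<in> P \<or> inv x \<in> P"
proof -
  define \<A> where "\<A> = {P. P \<subseteq> carrier G \<and> \<one> \<notin> P \<and> (\<forall>x\<in>P. \<forall>y\<in>P. x \<otimes> y \<in> P)}"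
  have "\<Union>\<C> \<in> \<A>" if \<C>: "subset.chain \<A> \<C>" for \<C>
  proof -
    have "x \<otimes> y \<in> \<Union>\<C>" if xy: "x \<in> U" "U \<in> \<C>" "y \<in> W" "W \<in> \<C>" for x y U W
    proof -
      have "U \<subseteq> W \<or> W \<subseteq> U"
        using \<C> xy by (auto simp: subset.chain_def)
      then obtain T where "T \<in> \<C>" "x \<in> T" "y \<in> T"
        using xy by blast
      then show ?thesis
        using \<C> by (auto simp: subset.chain_def \<A>_def)
    qed
    then show ?thesis
      using \<C> by (auto simp: subset.chain_def \<A>_def)
  qed
  then obtain P where P: "P \<in> \<A>" "\<And>U. \<lbrakk>U \<in> \<A>; P \<subseteq> U\<rbrakk> \<Longrightarrow> U = P"
    using subset_Zorn'[of \<A>] by blast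
  have PG: "P \<subseteq> carrier G" "\<one> \<notin> P" "\<And>x y. \<lbrakk>x \<in> P; y \<in> P\<rbrakk> \<Longrightarrow> x \<otimes> y \<in> P"
    using P(1) by (auto simp: \<A>_def)
  have P_pow: "x [^] Suc n \<in> P" if "x \<in> P" for x n
    using that PG by (induction n) auto
  \<comment> \<open>Otherwise \<open>P\<close> and \<open>x\<close> together would generate a larger
    subsemigroup without the identity. The set \<open>insert \<one> P\<close> lets pure positive
    powers of \<open>x\<close> count among the new elements.\<close>
  have adjoin: "\<exists>q\<in>insert \<one> P. \<exists>n. q \<otimes> x [^] Suc n = \<one>" if x: "x \<in> carrier G" "x \<notin> P" for x
  proof (rule ccontr)
    assume none: "\<not> ?thesis"
    define P' where "P' = P \<union> {q \<otimes> x [^] Suc n | q n. q \<in> insert \<one> P}"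
    have "y \<otimes> z \<in> P'" if yz: "y \<in> P'" "z \<in> P'" for y z
    proof -
      have mixed: "y \<otimes> z \<in> P'" if y: "y \<in> P" and z: "z \<in> P'" for y z
      proof (cases "z \<in> P")
        case False
        then obtain q n where "z = q \<otimes> x [^] Suc n" "q \<in> insert \<one> P"
          using z by (auto simp: P'_def)
        moreover have "y \<otimes> (q \<otimes> x [^] Suc n) = (y \<otimes> q) \<otimes> x [^] Suc n" "y \<otimes> q \<in> insert \<one> P"
          using calculation(2) y x PG by (auto simp: m_assoc subset_iff)
        ultimately show ?thesis
          unfolding P'_def by blast
      qed (use y PG in \<open>auto simp: P'_def\<close>)
      have P'G: "u \<in> carrier G" if "u \<in> P'" for u
        using that x PG(1) by (auto simp: P'_def)
      show ?thesis
      proof (cases "y \<in> P \<or> z \<in> P")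
        case True
        then show ?thesis
          using mixed yz m_comm[of y z] P'G by metis
      next
        case False
        then obtain q n r m where y: "y = q \<otimes> x [^] Suc n" "q \<in> insert \<one> P"
          and z: "z = r \<otimes> x [^] Suc m" "r \<in> insert \<one> P"
          using yz by (auto simp: P'_def)
        have "q \<otimes> r \<in> insert \<one> P" "q \<in> carrier G" "r \<in> carrier G"
          using y z PG by (auto simp: subset_iff)
        moreover have "x [^] Suc n \<otimes> x [^] Suc m = x [^] Suc (Suc (n + m))"
          using x nat_pow_mult[of x "Suc n" "Suc m"] by simp
        then have "y \<otimes> z = (q \<otimes> r) \<otimes> x [^] Suc (Suc (n + m))"
          using calculation x y z by (simp add: m_ac del: nat_pow_Suc)
        ultimately show ?thesis
          unfolding P'_def by blast
      qed
    qed
    moreover have "\<one> \<notin> P'"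
      using none PG(2) unfolding P'_def by (auto dest: sym)
    moreover have "P' \<subseteq> carrier G"
      using x PG(1) by (auto simp: P'_def)
    ultimately have "P' = P"
      using P(2)[of P'] by (auto simp: \<A>_def P'_def)
    moreover have "\<one> \<otimes> x [^] Suc 0 \<in> P'"
      unfolding P'_def by blast
    ultimately show False
      using x by simp
  qed
  have "x \<in> P \<or> inv x \<in> P" if x: "x \<in> carrier G" "x \<noteq> \<one>" for x
  proof (rule ccontr)
    assume "\<not> ?thesis"
    then obtain q n r m where q: "q \<in> insert \<one> P" "q \<otimes> x [^] Suc n = \<one>"
      and r: "r \<in> insert \<one> P" "r \<otimes> (inv x) [^] Suc m = \<one>"
      using adjoin[of x] adjoin[of "inv x"] inv_closed[OF x(1)] x by meson
    have torsion_free: "y [^] Suc k \<noteq> \<one>" if "y \<in> carrier G" "y \<noteq> \<one>" for y k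
      using assms that by (metis torsion_free_group_def zero_less_Suc)
    \<comment> \<open>If \<open>q\<close> or \<open>r\<close> were the identity, a positive power of
      \<open>x\<close> or of its inverse would be trivial. This is where torsion-freeness
      enters.\<close>
    have qr: "q \<in> P" "r \<in> P"
      using q r torsion_free[of x n] torsion_free[of "inv x" m] x by (auto simp del: nat_pow_Suc)
    then have qrG: "q \<in> carrier G" "r \<in> carrier G"
      using PG by auto
    \<comment> \<open>Raising the two relations to the powers \<open>m + 1\<close> and
      \<open>n + 1\<close> gives \<open>x\<close> and its inverse the same exponent. They cancel,
      and a product of elements of \<open>P\<close> equals the identity.\<close>
    have "(q \<otimes> x [^] Suc n) [^] Suc m \<otimes> (r \<otimes> (inv x) [^] Suc m) [^] Suc n = \<one>"
      using q r by (simp del: nat_pow_Suc add: nat_pow_one)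
    moreover have "(q \<otimes> x [^] Suc n) [^] Suc m \<otimes> (r \<otimes> (inv x) [^] Suc m) [^] Suc n =
        (q [^] Suc m \<otimes> r [^] Suc n) \<otimes> ((x \<otimes> inv x) [^] (Suc n * Suc m))"
      using qrG x by (simp only: nat_pow_distrib nat_pow_pow nat_pow_closed inv_closed m_ac m_closed
        mult.commute[of "Suc m" "Suc n"])
    ultimately have "q [^] Suc m \<otimes> r [^] Suc n = \<one>"
      using x qrG by (simp del: nat_pow_Suc add: nat_pow_one)
    then show False
      using PG P_pow qr by metis
  qed
  then show thesis
    using that PG by blast
qed

section \<open>The order on the degrees and the leading part of a derivation\<close>

locale ordered_lnd = graded_algebra R G B K + lnd_domain R D
  for R (structure) and G and B and K and D +
  fixes P
  assumes P_carrier: "P \<subseteq> carrier G" and P_one: "\<one>\<^bsub>G\<^esub> \<notin> P"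
    and P_mult: "\<lbrakk>x \<in> P; y \<in> P\<rbrakk> \<Longrightarrow> x \<otimes>\<^bsub>G\<^esub> y \<in> P"
    and P_total: "\<lbrakk>x \<in> carrier G; x \<noteq> \<one>\<^bsub>G\<^esub>\<rbrakk> \<Longrightarrow> x \<in> P \<or> inv\<^bsub>G\<^esub> x \<in> P"
begin

definition less :: "'c \<Rightarrow> 'c \<Rightarrow> bool" (infix \<open>\<lless>\<close> 50) where
  "i \<lless> j \<longleftrightarrow> inv\<^bsub>G\<^esub> i \<otimes>\<^bsub>G\<^esub> j \<in> P"

lemma less_irrefl: "i \<in> carrier G \<Longrightarrow> \<not> i \<lless> i"
  using P_one by (simp add: less_def)

lemma less_trans:
  assumes "i \<in> carrier G" "j \<in> carrier G" "k \<in> carrier G" "i \<lless> j" "j \<lless> k"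
  shows "i \<lless> k"
proof -
  have "(inv\<^bsub>G\<^esub> i \<otimes>\<^bsub>G\<^esub> j) \<otimes>\<^bsub>G\<^esub> (inv\<^bsub>G\<^esub> j \<otimes>\<^bsub>G\<^esub> k) = inv\<^bsub>G\<^esub> i \<otimes>\<^bsub>G\<^esub> ((j \<otimes>\<^bsub>G\<^esub> inv\<^bsub>G\<^esub> j) \<otimes>\<^bsub>G\<^esub> k)"
    using assms(1-3) by (simp only: G.m_assoc G.m_closed G.inv_closed)
  then show ?thesis
    using P_mult[of "inv\<^bsub>G\<^esub> i \<otimes>\<^bsub>G\<^esub> j" "inv\<^bsub>G\<^esub> j \<otimes>\<^bsub>G\<^esub> k"] assms by (simp add: less_def)
qed

lemma less_total:
  assumes "i \<in> carrier G" "j \<in> carrier G"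
  shows "i = j \<or> i \<lless> j \<or> j \<lless> i"
proof (cases "inv\<^bsub>G\<^esub> i \<otimes>\<^bsub>G\<^esub> j = \<one>\<^bsub>G\<^esub>")
  case True
  then show ?thesis
    using assms by (metis G.inv_comm G.inv_equality G.inv_inv G.inv_closed)
next
  case False
  then show ?thesis
    using P_total[of "inv\<^bsub>G\<^esub> i \<otimes>\<^bsub>G\<^esub> j"] assms by (auto simp: less_def G.inv_mult_group)
qed

lemma less_mult_right:
  assumes "i \<in> carrier G" "j \<in> carrier G" "k \<in> carrier G"
  shows "i \<otimes>\<^bsub>G\<^esub> k \<lless> j \<otimes>\<^bsub>G\<^esub> k \<longleftrightarrow> i \<lless> j"
proof -
  have "inv\<^bsub>G\<^esub> (i \<otimes>\<^bsub>G\<^esub> k) \<otimes>\<^bsub>G\<^esub> (j \<otimes>\<^bsub>G\<^esub> k) = (inv\<^bsub>G\<^esub> i \<otimes>\<^bsub>G\<^esub> j) \<otimes>\<^bsub>G\<^esub> (inv\<^bsub>G\<^esub> k \<otimes>\<^bsub>G\<^esub> k)"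
    using assms by (simp only: G.inv_mult_group G.m_ac G.m_closed G.inv_closed)
  then show ?thesis
    using assms by (simp add: less_def)
qed

lemma finite_has_greatest:
  assumes "finite F" "F \<noteq> {}" "F \<subseteq> carrier G"
  shows "\<exists>t\<in>F. \<forall>i\<in>F. i = t \<or> i \<lless> t"
  using assms
proof (induction rule: finite_ne_induct)
  case (insert x F)
  then obtain t where t: "t \<in> F" "\<forall>i\<in>F. i = t \<or> i \<lless> t"
    by auto
  consider "x = t \<or> x \<lless> t" | "t \<lless> x"
    using less_total[of x t] insert.prems t by auto
  then show ?case
  proof cases
    case 2
    then have "\<forall>i\<in>insert x F. i = x \<or> i \<lless> x"
      using t insert.prems less_trans[OF _ _ _ _ 2] by (metis insert_iff subsetD)
    then show ?thesis by blast
  qed (use t in auto)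
qed simp

text \<open>With \<open>upto\<close>, this is the filtration of the ring by the ordered degrees; for
  \<open>g\<close> in the group, the quotient of \<open>upto g\<close> by \<open>below g\<close> is
  a copy of \<open>B g\<close>.\<close>

definition below :: "'c \<Rightarrow> 'a set" where
  "below g = {x \<in> carrier R. \<forall>i\<in>carrier G. proj i x \<noteq> \<zero> \<longrightarrow> i \<lless> g}"

definition upto :: "'c \<Rightarrow> 'a set" where
  "upto g = {x \<in> carrier R. \<forall>i\<in>carrier G. proj i x \<noteq> \<zero> \<longrightarrow> i = g \<or> i \<lless> g}"

lemma below_add: "\<lbrakk>x \<in> below g; y \<in> below g\<rbrakk> \<Longrightarrow> x \<oplus> y \<in> below g"
  by (fastforce simp: below_def)

lemma upto_add: "\<lbrakk>x \<in> upto g; y \<in> upto g\<rbrakk> \<Longrightarrow> x \<oplus> y \<in> upto g"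
  by (fastforce simp: upto_def)

lemma upto_minus: "x \<in> upto g \<Longrightarrow> \<ominus> x \<in> upto g"
  by (fastforce simp: upto_def)

lemma upto_zero: "\<zero> \<in> upto g"
  by (simp add: upto_def)

lemma below_zero: "\<zero> \<in> below g"
  by (simp add: below_def)

lemma upto_subset_below:
  "\<lbrakk>g \<in> carrier G; h \<in> carrier G; g \<lless> h; x \<in> upto g\<rbrakk> \<Longrightarrow> x \<in> below h"
  using less_trans[of _ g h] by (auto simp: upto_def below_def)

lemma upto_mult:
  assumes "g \<in> carrier G" "j \<in> carrier G" "y \<in> B j" "x \<in> upto g"
  shows "y \<otimes> x \<in> upto (g \<otimes>\<^bsub>G\<^esub> j)"
proof -
  have R: "x \<in> carrier R" "y \<in> carrier R"
    using assms component_subset by (auto simp: upto_def)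
  have "i = g \<otimes>\<^bsub>G\<^esub> j \<or> i \<lless> g \<otimes>\<^bsub>G\<^esub> j" if i: "i \<in> carrier G" "proj i (y \<otimes> x) \<noteq> \<zero>" for i
  proof -
    let ?k = "i \<otimes>\<^bsub>G\<^esub> inv\<^bsub>G\<^esub> j"
    have k: "?k \<in> carrier G" "?k \<otimes>\<^bsub>G\<^esub> j = i"
      using i assms by (auto simp: G.m_assoc)
    then have "y \<otimes> proj ?k x \<noteq> \<zero>"
      using proj_mult_homogeneous[of ?k j y x] i assms R by simp
    then have "proj ?k x \<noteq> \<zero>"
      using R by auto
    then have "?k = g \<or> ?k \<lless> g"
      using assms(4) k by (auto simp: upto_def)
    then show ?thesis
      using less_mult_right[of ?k g j] k assms by auto
  qed
  then show ?thesis
    using R by (simp add: upto_def)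
qed

text \<open>The part of \<open>D\<close> that raises degrees by exactly \<open>t\<close>. It is a
  derivation for every \<open>t\<close> in the group; local nilpotency will be shown when
  \<open>t\<close> is the greatest degree occurring in \<open>D\<close>.\<close>

definition component :: "'c \<Rightarrow> 'a \<Rightarrow> 'a" where
  "component t = (\<lambda>x\<in>carrier R. \<Oplus>i\<in>supp x. proj (i \<otimes>\<^bsub>G\<^esub> t) (D (proj i x)))"

lemma component_eq_finsum:
  assumes "t \<in> carrier G" "x \<in> carrier R" "finite F" "supp x \<subseteq> F" "F \<subseteq> carrier G"
  shows "component t x = (\<Oplus>i\<in>F. proj (i \<otimes>\<^bsub>G\<^esub> t) (D (proj i x)))"
proof -
  have "(\<Oplus>i\<in>supp x. proj (i \<otimes>\<^bsub>G\<^esub> t) (D (proj i x))) = (\<Oplus>i\<in>F. proj (i \<otimes>\<^bsub>G\<^esub> t) (D (proj i x)))"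
    using assms by (intro add.finprod_mono_neutral_cong_left) (auto simp: supp_def)
  then show ?thesis
    using assms(2) by (simp add: component_def)
qed

lemma component_homogeneous:
  assumes "t \<in> carrier G" "i \<in> carrier G" "x \<in> B i"
  shows "component t x = proj (i \<otimes>\<^bsub>G\<^esub> t) (D x)"
proof -
  have x: "x \<in> carrier R"
    using assms component_subset by blast
  have "supp x \<subseteq> {i}"
    using assms by (auto simp: supp_def proj_homogeneous split: if_splits)
  then have "component t x = (\<Oplus>j\<in>{i}. proj (j \<otimes>\<^bsub>G\<^esub> t) (D (proj j x)))"
    using assms x by (intro component_eq_finsum) auto
  then show ?thesis
    using assms x by (simp add: proj_homogeneous)
qed

lemma component_add:
  assumes "t \<in> carrier G" "x \<in> carrier R" "y \<in> carrier R"
  shows "component t (x \<oplus> y) = component t x \<oplus> component t y"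
proof -
  define F where "F = supp x \<union> supp y \<union> supp (x \<oplus> y)"
  have F: "finite F" "F \<subseteq> carrier G"
    using assms proj_spec(2) supp_subset by (auto simp: F_def)
  let ?f = "\<lambda>x i. proj (i \<otimes>\<^bsub>G\<^esub> t) (D (proj i x))"
  have f: "?f x i \<in> carrier R" if "x \<in> carrier R" "i \<in> F" for x i
    using that F assms(1) by auto
  have "component t (x \<oplus> y) = finsum R (?f (x \<oplus> y)) F"
    using assms F by (intro component_eq_finsum) (auto simp: F_def)
  also have "\<dots> = (\<Oplus>i\<in>F. ?f x i \<oplus> ?f y i)"
    using assms F f by (intro finsum_cong') (auto simp: subset_iff)
  also have "\<dots> = finsum R (?f x) F \<oplus> finsum R (?f y) F"
    using assms f by (intro finsum_addf) auto
  also have "finsum R (?f x) F = component t x"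
    using assms F by (intro component_eq_finsum[symmetric]) (auto simp: F_def)
  also have "finsum R (?f y) F = component t y"
    using assms F by (intro component_eq_finsum[symmetric]) (auto simp: F_def)
  finally show ?thesis .
qed

lemma component_closed:
  "\<lbrakk>t \<in> carrier G; x \<in> carrier R\<rbrakk> \<Longrightarrow> component t x \<in> carrier R"
  using supp_subset[of x] by (auto simp: component_def intro!: finsum_closed)

lemma component_degree:
  "\<lbrakk>t \<in> carrier G; i \<in> carrier G; x \<in> B i\<rbrakk> \<Longrightarrow> component t x \<in> B (i \<otimes>\<^bsub>G\<^esub> t)"
  using component_subset[of i x] by (simp add: component_homogeneous proj_in)

text \<open>Both sides are additive in each factor, so \<open>x\<close> and \<open>y\<close> may be
  taken homogeneous of degrees \<open>i\<close> and \<open>j\<close>. The claim is then the part of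
  the product rule for \<open>D\<close> in degree \<open>i + j + t\<close>.\<close>

lemma component_mult_rule:
  assumes t: "t \<in> carrier G" and x: "x \<in> carrier R" and y: "y \<in> carrier R"
  shows "component t (x \<otimes> y) = component t x \<otimes> y \<oplus> x \<otimes> component t y"
  using x
proof (induction x rule: homogeneous_induct)
  case zero
  then show ?case
    using component_homogeneous[of t "\<one>\<^bsub>G\<^esub>" \<zero>] t y component_closed by simp
next
  case (add u v)
  then show ?case
    using t y component_closed by (simp add: component_add l_distr a_ac)
next
  case (homogeneous i x)
  have xR: "x \<in> carrier R"
    using homogeneous component_subset by blast
  show ?case
    using y
  proof (induction y rule: homogeneous_induct)
    case zero
    then show ?case
      using component_homogeneous[of t "\<one>\<^bsub>G\<^esub>" \<zero>] t xR component_closed by simp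
  next
    case (add u v)
    then show ?case
      using t xR component_closed by (simp add: component_add r_distr a_ac)
  next
    case y: (homogeneous j y)
    have yR: "y \<in> carrier R"
      using y component_subset by blast
    have 1: "proj (i \<otimes>\<^bsub>G\<^esub> j \<otimes>\<^bsub>G\<^esub> t) (y \<otimes> D x) = y \<otimes> proj (i \<otimes>\<^bsub>G\<^esub> t) (D x)"
      using proj_mult_homogeneous[of "i \<otimes>\<^bsub>G\<^esub> t" j y "D x"] homogeneous y t xR
      by (simp add: G.m_ac)
    have 2: "proj (i \<otimes>\<^bsub>G\<^esub> j \<otimes>\<^bsub>G\<^esub> t) (x \<otimes> D y) = x \<otimes> proj (j \<otimes>\<^bsub>G\<^esub> t) (D y)"
      using proj_mult_homogeneous[of "j \<otimes>\<^bsub>G\<^esub> t" i x "D y"] homogeneous y t yR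
      by (simp add: G.m_ac)
    have "component t (x \<otimes> y) = proj (i \<otimes>\<^bsub>G\<^esub> j \<otimes>\<^bsub>G\<^esub> t) (D (x \<otimes> y))"
      using homogeneous y t component_mult by (intro component_homogeneous) auto
    also have "D (x \<otimes> y) = y \<otimes> D x \<oplus> x \<otimes> D y"
      using xR yR by (simp add: D_mult m_comm)
    finally show ?case
      using 1 2 homogeneous y t xR yR by (simp add: component_homogeneous m_comm)
  qed
qed

lemma derivation_component: "t \<in> carrier G \<Longrightarrow> component t \<in> derivations R"
  using component_closed component_add component_mult_rule
  by (auto simp: derivations_def) (simp add: component_def)

text \<open>If \<open>D\<close> raises degrees by at most \<open>t\<close>, the iterates of
  \<open>D\<close> and of its part of degree \<open>t\<close> agree up to strictly lower terms.
  Lower terms remain lower after one more application of \<open>D\<close>, because the order is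
  compatible with the group operation.\<close>

lemma leading_component:
  assumes t: "t \<in> carrier G"
    and bound: "\<And>i x. \<lbrakk>i \<in> carrier G; x \<in> B i\<rbrakk> \<Longrightarrow> D x \<in> upto (i \<otimes>\<^bsub>G\<^esub> t)"
    and x: "j \<in> carrier G" "x \<in> B j"
  shows "(component t ^^ n) x \<in> B (j \<otimes>\<^bsub>G\<^esub> t [^]\<^bsub>G\<^esub> n) \<and>
    (D ^^ n) x \<ominus> (component t ^^ n) x \<in> below (j \<otimes>\<^bsub>G\<^esub> t [^]\<^bsub>G\<^esub> n)"
proof (induction n)
  case 0
  then show ?case
    using x component_subset[of j x] below_zero by (simp add: a_minus_def r_neg)
next
  case (Suc n)
  let ?g = "j \<otimes>\<^bsub>G\<^esub> t [^]\<^bsub>G\<^esub> n" and ?u = "(component t ^^ n) x"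
  let ?v = "(D ^^ n) x \<ominus> ?u"
  have g: "?g \<in> carrier G" "j \<otimes>\<^bsub>G\<^esub> t [^]\<^bsub>G\<^esub> Suc n = ?g \<otimes>\<^bsub>G\<^esub> t"
    using x t by (auto simp: G.m_assoc)
  have u: "?u \<in> carrier R" and v: "?v \<in> carrier R"
    using Suc g(1) component_subset by (auto simp: below_def)
  \<comment> \<open>The error from the previous iterates: each of its components has degree
    \<open>i\<close> strictly below \<open>?g\<close>, and \<open>D\<close> sends it to degrees at
    most \<open>i + t\<close>.\<close>
  have D_below: "D ?v \<in> below (?g \<otimes>\<^bsub>G\<^esub> t)"
  proof -
    have "D (\<Oplus>i\<in>F. proj i ?v) \<in> below (?g \<otimes>\<^bsub>G\<^esub> t)" if "finite F" "F \<subseteq> supp ?v" for F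
      using that
    proof (induction F)
      case empty
      then show ?case
        using below_zero by simp
    next
      case (insert i F)
      then have i: "i \<in> carrier G" "i \<lless> ?g" and F: "F \<subseteq> carrier G"
        using Suc supp_subset[of ?v] by (auto simp: below_def supp_def)
      have "D (\<Oplus>i\<in>insert i F. proj i ?v) = D (proj i ?v) \<oplus> D (\<Oplus>i\<in>F. proj i ?v)"
        using insert i F v by (subst finsum_insert) (auto intro!: D_add finsum_closed)
      moreover have "D (proj i ?v) \<in> below (?g \<otimes>\<^bsub>G\<^esub> t)"
        using upto_subset_below[OF _ _ _ bound[OF i(1) proj_in[OF i(1) v]]] i g t
        by (simp add: less_mult_right)
      ultimately show ?case
        using insert below_add by auto
    qed
    then have "D (\<Oplus>i\<in>supp ?v. proj i ?v) \<in> below (?g \<otimes>\<^bsub>G\<^esub> t)"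
      using proj_spec(2)[OF v] by blast
    then show ?thesis
      using proj_spec(3)[OF v] by (rule ssubst[where P = "\<lambda>z. D z \<in> below (?g \<otimes>\<^bsub>G\<^esub> t)", rotated])
  qed
  have cu: "component t ?u = proj (?g \<otimes>\<^bsub>G\<^esub> t) (D ?u)"
    using Suc g t by (intro component_homogeneous) auto
  \<comment> \<open>The new error: removing from \<open>D ?u\<close> its component in the highest
    possible degree leaves only lower ones.\<close>
  have "D ?u \<ominus> component t ?u \<in> below (?g \<otimes>\<^bsub>G\<^esub> t)"
  proof -
    have "i \<lless> ?g \<otimes>\<^bsub>G\<^esub> t" if i: "i \<in> carrier G" "proj i (D ?u \<ominus> component t ?u) \<noteq> \<zero>" for i
    proof -
      have "proj i (component t ?u) = (if i = ?g \<otimes>\<^bsub>G\<^esub> t then proj i (D ?u) else \<zero>)"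
        using cu proj_homogeneous[OF _ component_degree[OF t g(1)], of ?u i] Suc i g t by simp
      then have "i \<noteq> ?g \<otimes>\<^bsub>G\<^esub> t" "proj i (D ?u) \<noteq> \<zero>"
        using i u t component_closed by (auto simp: a_minus_def r_neg split: if_splits)
      then show ?thesis
        using bound[OF g(1), of ?u] Suc i by (auto simp: upto_def)
    qed
    then show ?thesis
      using u t component_closed by (auto simp: below_def)
  qed
  then have "(D ?u \<ominus> component t ?u) \<oplus> D ?v \<in> below (?g \<otimes>\<^bsub>G\<^esub> t)"
    using D_below below_add by blast
  moreover have "(D ?u \<ominus> component t ?u) \<oplus> D ?v = D ((D ^^ n) x) \<ominus> component t ?u"
  proof -
    have "D ?v = D ((D ^^ n) x) \<ominus> D ?u"
      using u x component_subset[of j x] by (simp add: a_minus_def)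
    moreover have "(a \<ominus> b) \<oplus> (c \<ominus> a) = c \<ominus> b"
      if "a \<in> carrier R" "b \<in> carrier R" "c \<in> carrier R" for a b c
      using that by algebra
    ultimately show ?thesis
      using u x t component_subset[of j x] component_closed by simp
  qed
  ultimately show ?case
    using component_degree[OF t g(1)] Suc g(2) by simp
qed

text \<open>Finite generation gives \<open>D\<close> a degree: only finitely many shifts occur on
  the homogeneous generators, and the greatest of them bounds the shift on the whole ring. The
  leading part of \<open>D\<close> in that degree is the required derivation.\<close>

lemma homogeneous_lnd_exists:
  assumes "finite S0" "S0 \<subseteq> carrier R" "generate_ring R (K \<union> S0) = carrier R"
    and nonzero: "z \<in> carrier R" "D z \<noteq> \<zero>"
  shows "\<exists>T\<in>HLND G R B. T \<noteq> zero_derivation R"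
proof -
  obtain S \<delta> where S: "finite S" "generate_ring R (K \<union> S) = carrier R"
    and \<delta>: "\<And>b. b \<in> S \<Longrightarrow> \<delta> b \<in> carrier G \<and> b \<in> B (\<delta> b) \<and> b \<noteq> \<zero>"
    using homogeneous_generators[OF assms(1-3)] by metis
  have SR: "b \<in> carrier R" if "b \<in> S" for b
    using \<delta>[OF that] component_subset by blast
  have "\<exists>b\<in>S. D b \<noteq> \<zero>"
  proof (rule ccontr)
    assume none: "\<not> ?thesis"
    have "x \<in> carrier R \<and> D x = \<zero>" if "x \<in> generate_ring R (K \<union> S)" for x
      using that
    proof induction
      case (incl h)
      then show ?case
        using none SR D_subfield[OF ground_subfield] subringE(1)[OF subfieldE(1)[OF ground_subfield]] by auto
    qed (auto simp: D_mult)
    then show False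
      using nonzero S(2) by blast
  qed
  then obtain b0 where b0: "b0 \<in> S" "D b0 \<noteq> \<zero>"
    by blast
  \<comment> \<open>All differences between the degree of a component of \<open>D b\<close> and the
    degree of the generator \<open>b\<close>.\<close>
  define F where "F = (\<Union>b\<in>S. (\<lambda>g. g \<otimes>\<^bsub>G\<^esub> inv\<^bsub>G\<^esub> (\<delta> b)) ` supp (D b))"
  have "finite F" "F \<subseteq> carrier G"
    using S(1) SR \<delta> proj_spec(2) supp_subset by (auto simp: F_def subset_iff)
  moreover have "F \<noteq> {}"
    using b0 eq_zero_proj[of "D b0"] SR by (auto simp: F_def supp_def)
  ultimately obtain t where t: "t \<in> F" "\<forall>i\<in>F. i = t \<or> i \<lless> t" "t \<in> carrier G"
    using finite_has_greatest[of F] by blast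
  \<comment> \<open>The bound holds on generators by the choice of \<open>t\<close>; scalars are
    killed, and the product rule preserves it, so \<open>graded_induct\<close> spreads it to every
    homogeneous element.\<close>
  have bound: "D x \<in> upto (j \<otimes>\<^bsub>G\<^esub> t)" if "j \<in> carrier G" "x \<in> B j" for j x
  proof -
    have "x \<in> {x \<in> carrier R. D x \<in> upto (j \<otimes>\<^bsub>G\<^esub> t)}"
    proof (rule graded_induct[where S = S and \<delta> = \<delta>
          and Q = "\<lambda>j. {x \<in> carrier R. D x \<in> upto (j \<otimes>\<^bsub>G\<^esub> t)}"])
      fix b assume b: "b \<in> S"
      have "i = \<delta> b \<otimes>\<^bsub>G\<^esub> t \<or> i \<lless> \<delta> b \<otimes>\<^bsub>G\<^esub> t" if i: "i \<in> carrier G" "proj i (D b) \<noteq> \<zero>" for i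
      proof -
        let ?k = "i \<otimes>\<^bsub>G\<^esub> inv\<^bsub>G\<^esub> (\<delta> b)"
        have "?k \<in> F"
          using b i by (auto simp: F_def supp_def)
        then have "?k = t \<or> ?k \<lless> t"
          using t by blast
        moreover have "?k \<in> carrier G" "?k \<otimes>\<^bsub>G\<^esub> \<delta> b = i"
          using i \<delta>[OF b] by (auto simp: G.m_assoc)
        ultimately show ?thesis
          using less_mult_right[of ?k t "\<delta> b"] t(3) \<delta>[OF b] G.m_comm[of "\<delta> b" t] by auto
      qed
      then show "\<delta> b \<in> carrier G \<and> b \<in> B (\<delta> b) \<and> b \<in> {x \<in> carrier R. D x \<in> upto (\<delta> b \<otimes>\<^bsub>G\<^esub> t)}"
        using \<delta>[OF b] SR[OF b] by (simp add: upto_def)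
    next
      show "K \<subseteq> {x \<in> carrier R. D x \<in> upto (\<one>\<^bsub>G\<^esub> \<otimes>\<^bsub>G\<^esub> t)}"
        using D_subfield[OF ground_subfield] upto_zero subringE(1)[OF subfieldE(1)[OF ground_subfield]] by auto
    next
      fix i assume "i \<in> carrier G"
      show "additive_subgroup {x \<in> carrier R. D x \<in> upto (i \<otimes>\<^bsub>G\<^esub> t)} R"
        using upto_add upto_zero upto_minus
        by (intro additive_subgroup.intro add.subgroupI) auto
    next
      fix i k x y
      assume i: "i \<in> carrier G" "x \<in> B i" and k: "k \<in> carrier G" "y \<in> B k"
        and x: "x \<in> {x \<in> carrier R. D x \<in> upto (i \<otimes>\<^bsub>G\<^esub> t)}"
        and y: "y \<in> {x \<in> carrier R. D x \<in> upto (k \<otimes>\<^bsub>G\<^esub> t)}"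
      have "y \<otimes> D x \<in> upto (i \<otimes>\<^bsub>G\<^esub> k \<otimes>\<^bsub>G\<^esub> t)"
        using upto_mult[of "i \<otimes>\<^bsub>G\<^esub> t" k y "D x"] x i k t by (simp add: G.m_ac)
      moreover have "x \<otimes> D y \<in> upto (i \<otimes>\<^bsub>G\<^esub> k \<otimes>\<^bsub>G\<^esub> t)"
        using upto_mult[of "k \<otimes>\<^bsub>G\<^esub> t" i x "D y"] y i k t by (simp add: G.m_ac)
      ultimately show "x \<otimes> y \<in> {x \<in> carrier R. D x \<in> upto (i \<otimes>\<^bsub>G\<^esub> k \<otimes>\<^bsub>G\<^esub> t)}"
        using x y upto_add by (simp add: D_mult m_comm)
    qed (use S(2) that in auto)
    then show ?thesis by simp
  qed
  interpret T: derivation R "component t"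
    using derivation_component[OF t(3)] by unfold_locales
  have nilpotent: "\<exists>n. (component t ^^ n) x = \<zero>" if "x \<in> carrier R" for x
    using that
  proof (induction x rule: homogeneous_induct)
    case zero
    show ?case
      by (intro exI[of _ 0]) simp
  next
    case (add x y)
    then obtain m n where "(component t ^^ m) x = \<zero>" "(component t ^^ n) y = \<zero>"
      by blast
    then have "(component t ^^ max m n) (x \<oplus> y) = \<zero>"
      using add T.iter_add T.iter_zero_mono[of m x "max m n"] T.iter_zero_mono[of n y "max m n"] by simp
    then show ?case by blast
  next
    case (homogeneous j x)
    have x: "x \<in> carrier R"
      using homogeneous component_subset by blast
    then obtain n where n: "(D ^^ n) x = \<zero>"
      using locally_nilpotent by blast
    let ?g = "j \<otimes>\<^bsub>G\<^esub> t [^]\<^bsub>G\<^esub> n" and ?u = "(component t ^^ n) x"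
    have g: "?g \<in> carrier G"
      using homogeneous t by simp
    have u: "?u \<in> B ?g" "\<zero> \<ominus> ?u \<in> below ?g"
      using leading_component[OF t(3) bound homogeneous, of n] n by auto
    \<comment> \<open>As \<open>(D ^^ n) x = \<zero>\<close>, the element \<open>?u\<close> is
      homogeneous of degree \<open>?g\<close> while all its components lie strictly below
      \<open>?g\<close>. Hence it vanishes.\<close>
    then have "proj ?g (\<zero> \<ominus> ?u) = \<zero>"
      using less_irrefl[OF g] g unfolding below_def by blast
    then have "?u = \<zero>"
      using u(1) g x by (simp add: a_minus_def proj_homogeneous)
    then show ?case by blast
  qed
  have "\<exists>n>0. (component t ^^ n) x = \<zero>" if x: "x \<in> carrier R" for x
  proof -
    obtain n where "(component t ^^ n) x = \<zero>"
      using nilpotent x by blast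
    then have "(component t ^^ Suc n) x = \<zero>"
      by (rule T.iter_zero_mono) simp
    then show ?thesis by blast
  qed
  then have "component t \<in> HLND G R B"
    using derivation_component[OF t(3)] component_degree t(3)
    unfolding HLND_def LND_def homogeneous_def by blast
  moreover have "component t \<noteq> zero_derivation R"
  proof -
    \<comment> \<open>The maximum \<open>t\<close> is attained: some generator \<open>b\<close> has
      a nonzero component of \<open>D b\<close> in degree \<open>\<delta> b + t\<close>, and this is
      the value of \<open>component t\<close> at \<open>b\<close>.\<close>
    obtain b g where b: "b \<in> S" "g \<in> carrier G" "proj g (D b) \<noteq> \<zero>" "t = g \<otimes>\<^bsub>G\<^esub> inv\<^bsub>G\<^esub> (\<delta> b)"
      using t(1) by (auto simp: F_def supp_def)
    have "\<delta> b \<otimes>\<^bsub>G\<^esub> t = t \<otimes>\<^bsub>G\<^esub> \<delta> b"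
      using t(3) \<delta>[OF b(1)] by (simp add: G.m_comm)
    then have "\<delta> b \<otimes>\<^bsub>G\<^esub> t = g"
      using b \<delta>[OF b(1)] by (simp add: G.m_assoc)
    then have "component t b \<noteq> \<zero>"
      using component_homogeneous[OF t(3), of "\<delta> b" b] \<delta>[OF b(1)] b(3) by simp
    then show ?thesis
      using SR[OF b(1)] by (auto simp: zero_derivation_def)
  qed
  ultimately show ?thesis by blast
qed

end

subsection \<open>Rigidity of Veronese subrings\<close>

text \<open>A degree \<open>j\<close> with nonzero component lies in the support group, and a
  positive power of its coset is trivial; that power of \<open>j\<close> lies in the subgroup
  factored out, which is contained in \<open>H\<close>.\<close>

lemma (in graded_ring) support_torsion:
  assumes "H \<in> cotorsion_subgroups G R B" "j \<in> carrier G" "B j \<noteq> {\<zero>\<^bsub>R\<^esub>}"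
  shows "\<exists>n>0. j [^]\<^bsub>G\<^esub> (n::nat) \<in> H"
proof -
  define T where "T = support_group G R B"
  let ?T = "G\<lparr>carrier := T\<rparr>" and ?N = "H \<inter> T"
  have H: "subgroup H G" and torsion: "torsion_group (?T Mod ?N)"
    using assms(1) by (auto simp: cotorsion_subgroups_def T_def)
  have T: "subgroup T G"
    unfolding T_def support_group_def by (rule G.generate_is_subgroup) auto
  have j: "j \<in> T"
    unfolding T_def support_group_def using assms(2,3) by (intro generate.incl) auto
  interpret T: comm_group ?T
    using G.subgroup_imp_group[OF T] subgroup.mem_carrier[OF T]
    by (intro group.group_comm_groupI) (auto simp: G.m_comm)
  have "subgroup ?N ?T"
    using subgroup.subset[OF T] G.subgroups_Inter_pair[OF H T]
    by (intro G.subgroup_incl T) auto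
  then have "?N \<lhd> ?T"
    by (rule T.normal_iff_subgroup[THEN iffD2])
  then interpret N: normal ?N ?T .
  have "?N #>\<^bsub>?T\<^esub> j \<in> carrier (?T Mod ?N)"
    using j by (auto simp: FactGroup_def RCOSETS_def)
  then obtain n where n: "n > 0" "(?N #>\<^bsub>?T\<^esub> j) [^]\<^bsub>?T Mod ?N\<^esub> (n::nat) = ?N"
    using torsion unfolding torsion_group_def one_FactGroup by blast
  have "?N #>\<^bsub>?T\<^esub> (j [^]\<^bsub>?T\<^esub> n) = ?N"
    using n(2) N.FactGroup_pow[of j n] j by simp
  then have "j [^]\<^bsub>?T\<^esub> n \<in> ?N"
    using T.rcos_self[OF _ N.subgroup_axioms, of "j [^]\<^bsub>?T\<^esub> n"] j T.nat_pow_closed[of j n] by auto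
  then show ?thesis
    using n(1) G.nat_pow_consistent[of j n] by auto
qed

lemma (in domain) lnd_domain_if_LND:
  assumes "D \<in> LND R" "\<And>n. n > 0 \<Longrightarrow> [(n::nat)] \<cdot> \<one> \<noteq> \<zero>"
  shows "lnd_domain R D"
proof unfold_locales
  show "D \<in> derivations R" "\<And>x. x \<in> carrier R \<Longrightarrow> \<exists>n. (D ^^ n) x = \<zero>"
    using assms(1) by (auto simp: LND_def)
qed (use assms(2) in auto)

lemma zero_derivation_iff:
  assumes "D \<in> LND R"
  shows "D \<noteq> zero_derivation R \<longleftrightarrow> (\<exists>x\<in>carrier R. D x \<noteq> \<zero>\<^bsub>R\<^esub>)"
proof -
  have "D \<in> extensional (carrier R)"
    using assms by (auto simp: LND_def derivations_def PiE_def)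
  then have "D = zero_derivation R" if "\<forall>x\<in>carrier R. D x = \<zero>\<^bsub>R\<^esub>"
    using that by (intro extensionalityI[of _ "carrier R"]) (auto simp: zero_derivation_def)
  then show ?thesis
    by (auto simp: zero_derivation_def)
qed

text \<open>That a set differs from the singleton of the zero derivation gives a nonzero element
  only once the zero derivation is known to belong to it. Parts (c) and (d) use it in this
  way.\<close>

lemma zero_derivation_in_HLND:
  assumes "graded_ring G R B"
  shows "zero_derivation R \<in> HLND G R B"
proof -
  interpret graded_ring G R B
    by fact
  have "zero_derivation R \<in> derivations R"
    by (auto simp: derivations_def zero_derivation_def)
  moreover have "\<exists>n>0. (zero_derivation R ^^ n) x = \<zero>\<^bsub>R\<^esub>" if "x \<in> carrier R" for x
    using that by (intro exI[of _ 1]) (simp add: zero_derivation_def)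
  moreover have "zero_derivation R ` B i \<subseteq> B (i \<otimes>\<^bsub>G\<^esub> \<one>\<^bsub>G\<^esub>)" if "i \<in> carrier G" for i
    using that additive_subgroup.a_subset[OF component_subgroup]
      additive_subgroup.zero_closed[OF component_subgroup]
    by (fastforce simp: zero_derivation_def)
  ultimately show ?thesis
    unfolding HLND_def LND_def homogeneous_def using G.one_closed by blast
qed

theorem theorem3p2:
  fixes G :: "('g, 'n) monoid_scheme" and R :: "('a, 'm) ring_scheme"
    and K :: "'a set" and B :: "'g \<Rightarrow> 'a set" and H :: "'g set"
  assumes "affine_domain K R"
    and "characteristic_zero (R\<lparr>carrier := K\<rparr>)"
    and "graded_over K G R B"
    and "H \<in> cotorsion_subgroups G R B"
  shows "(\<forall>A \<in> KHLND G R B.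
            veronese R B H A \<in> KHLND (G\<lparr>carrier := H\<rparr>) (veronese_ring R B H) B)
       \<and> inj_on (veronese R B H) (KHLND G R B)
       \<and> (HLND G R B \<noteq> {zero_derivation R} \<longrightarrow>
            HLND (G\<lparr>carrier := H\<rparr>) (veronese_ring R B H) B
              \<noteq> {zero_derivation (veronese_ring R B H)})
       \<and> (torsion_free_group G \<and> \<not> rigid R \<longrightarrow> \<not> rigid (veronese_ring R B H))"
proof -
  obtain S where S: "finite S" "S \<subseteq> carrier R" "generate_ring R (K \<union> S) = carrier R"
    using assms(1) by (auto simp: affine_domain_def)
  have "domain R" "subfield K R" "graded_ring G R B" "K \<subseteq> B \<one>\<^bsub>G\<^esub>"
    using assms(1,3) by (auto simp: affine_domain_def graded_over_def)
  then interpret graded_algebra R G B K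
    by (intro graded_algebra.intro graded_algebra_axioms.intro)
  \<comment> \<open>The subfield has the same addition and the same unit element as the ring, so the
    integer multiples of one coincide.\<close>
  have char_zero: "[(n::nat)] \<cdot>\<^bsub>R\<^esub> \<one>\<^bsub>R\<^esub> \<noteq> \<zero>\<^bsub>R\<^esub>" if "n > 0" for n
    using assms(2) that by (simp add: characteristic_zero_def add_pow_def nat_pow_def)
  interpret cotorsion_graded_algebra R G B K H
  proof (intro cotorsion_graded_algebra.intro cotorsion_graded_algebra_axioms.intro)
    show "graded_algebra R G B K"
      by (fact graded_algebra_axioms)
    show "subgroup H G"
      using assms(4) by (simp add: cotorsion_subgroups_def)
  next
    fix j x assume "j \<in> carrier G" "x \<in> B j" "x \<noteq> \<zero>\<^bsub>R\<^esub>"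
    then show "\<exists>n>0. j [^]\<^bsub>G\<^esub> (n::nat) \<in> H"
      using support_torsion[OF assms(4)] by blast
  qed
  let ?G = "G\<lparr>carrier := H\<rparr>" and ?V = "veronese_ring R B H"
  have lnd: "\<exists>d. homogeneous_lnd R G B K H D d" if D: "D \<in> HLND G R B" for D
  proof -
    interpret lnd_domain R D
      using lnd_domain_if_LND[OF _ char_zero] D by (simp add: HLND_def)
    obtain d where "d \<in> carrier G" "\<And>i. i \<in> carrier G \<Longrightarrow> D ` B i \<subseteq> B (i \<otimes>\<^bsub>G\<^esub> d)"
      using D by (auto simp: HLND_def homogeneous_def)
    then have "homogeneous_lnd R G B K H D d"
      by unfold_locales blast+
    then show ?thesis by blast
  qed
  have KHLND_kernel: "\<exists>D\<in>HLND G R B. A = {x \<in> carrier R. D x = \<zero>\<^bsub>R\<^esub>} \<and> (\<exists>x\<in>carrier R. D x \<noteq> \<zero>\<^bsub>R\<^esub>)"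
    if "A \<in> KHLND G R B" for A
  proof -
    obtain D where D: "D \<in> HLND G R B" "D \<noteq> zero_derivation R" "A = a_kernel R R D"
      using \<open>A \<in> KHLND G R B\<close> unfolding KHLND_def by blast
    then have "\<exists>x\<in>carrier R. D x \<noteq> \<zero>\<^bsub>R\<^esub>"
      using zero_derivation_iff[of D R] by (simp add: HLND_def)
    then show ?thesis
      using D(1,3) unfolding a_kernel_def' by blast
  qed
  have a: "veronese R B H A \<in> KHLND ?G ?V B" if A: "A \<in> KHLND G R B" for A
  proof -
    obtain D x where D: "D \<in> HLND G R B" "A = {x \<in> carrier R. D x = \<zero>\<^bsub>R\<^esub>}"
      and x: "x \<in> carrier R" "D x \<noteq> \<zero>\<^bsub>R\<^esub>"
      using KHLND_kernel[OF A] by blast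
    obtain d where d: "homogeneous_lnd R G B K H D d"
      using lnd D by blast
    show ?thesis
      using homogeneous_lnd.veronese_kernel_in_KHLND[OF d S x] D(2) by simp
  qed
  \<comment> \<open>The statement is symmetric in \<open>A\<close> and \<open>A'\<close>, so its two
    instances give injectivity.\<close>
  have kernel_subset: "A \<subseteq> A'"
    if A: "A \<in> KHLND G R B" and A': "A' \<in> KHLND G R B"
      and eq: "veronese R B H A = veronese R B H A'" for A A'
  proof -
    obtain D where D: "D \<in> HLND G R B" "A = {x \<in> carrier R. D x = \<zero>\<^bsub>R\<^esub>}"
      using KHLND_kernel[OF A] by blast
    obtain D' where D': "D' \<in> HLND G R B" "A' = {x \<in> carrier R. D' x = \<zero>\<^bsub>R\<^esub>}"
      using KHLND_kernel[OF A'] by blast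
    obtain d d' where dd': "homogeneous_lnd R G B K H D d" "homogeneous_lnd R G B K H D' d'"
      using lnd D D' by blast
    interpret D: homogeneous_lnd R G B K H D d
      by (fact dd'(1))
    interpret D': homogeneous_lnd R G B K H D' d'
      by (fact dd'(2))
    have "{x \<in> V. D x = \<zero>\<^bsub>R\<^esub>} = {x \<in> V. D' x = \<zero>\<^bsub>R\<^esub>}"
      using eq unfolding D(2) D'(2) D.veronese_kernel D'.veronese_kernel .
    then have subset: "{x \<in> V. D x = \<zero>\<^bsub>R\<^esub>} \<subseteq> {x \<in> V. D' x = \<zero>\<^bsub>R\<^esub>}"
      by (rule equalityD1)
    show ?thesis
      unfolding D(2) D'(2)
      using D'.derivation_axioms subset D'.D_root by (rule D.homogeneous_kernel_subset)
  qed
  then have b: "inj_on (veronese R B H) (KHLND G R B)"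
    by (intro inj_onI equalityI) blast+
  \<comment> \<open>Part (a) applied to the kernel of \<open>D\<close> shows that
    \<open>KHLND\<close> of the Veronese subring is inhabited, and each of its members comes from a
    nonzero derivation.\<close>
  have nonzero: "\<exists>E\<in>HLND ?G ?V B. E \<noteq> zero_derivation ?V"
    if D: "D \<in> HLND G R B" "D \<noteq> zero_derivation R" for D
  proof -
    have "a_kernel R R D \<in> KHLND G R B"
      using D by (auto simp: KHLND_def)
    then have "KHLND ?G ?V B \<noteq> {}"
      using a by blast
    then show ?thesis
      by (auto simp: KHLND_def)
  qed
  have c: "HLND ?G ?V B \<noteq> {zero_derivation ?V}" if "HLND G R B \<noteq> {zero_derivation R}"
    using that nonzero zero_derivation_in_HLND[OF \<open>graded_ring G R B\<close>] by blast
  \<comment> \<open>Reduction to the homogeneous case: the cone \<open>P\<close> orders the degrees,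
    the leading part of a nonzero locally nilpotent derivation is homogeneous and nonzero, and
    \<open>nonzero\<close> transports it to the Veronese subring.\<close>
  have d: "\<not> rigid ?V" if torsion_free: "torsion_free_group G" and "\<not> rigid R"
  proof -
    have "zero_derivation R \<in> LND R"
      using zero_derivation_in_HLND[OF \<open>graded_ring G R B\<close>] by (simp add: HLND_def)
    then obtain D where D: "D \<in> LND R" "D \<noteq> zero_derivation R"
      using \<open>\<not> rigid R\<close> unfolding rigid_def by blast
    then obtain z where z: "z \<in> carrier R" "D z \<noteq> \<zero>\<^bsub>R\<^esub>"
      using zero_derivation_iff by blast
    interpret D: lnd_domain R D
      using lnd_domain_if_LND[OF D(1) char_zero] .
    obtain P where "P \<subseteq> carrier G" "\<one>\<^bsub>G\<^esub> \<notin> P" "\<And>x y. \<lbrakk>x \<in> P; y \<in> P\<rbrakk> \<Longrightarrow> x \<otimes>\<^bsub>G\<^esub> y \<in> P"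
      "\<And>x. \<lbrakk>x \<in> carrier G; x \<noteq> \<one>\<^bsub>G\<^esub>\<rbrakk> \<Longrightarrow> x \<in> P \<or> inv\<^bsub>G\<^esub> x \<in> P"
      using G.torsion_free_positive_cone[OF torsion_free] by metis
    then interpret ordered_lnd R G B K D P
      by unfold_locales blast+
    obtain T where "T \<in> HLND G R B" "T \<noteq> zero_derivation R"
      using homogeneous_lnd_exists[OF S z] by blast
    then show ?thesis
      using nonzero unfolding rigid_def HLND_def by blast
  qed
  show ?thesis
    using a b c d by blast
qed

end
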